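(* Let $(U,g)$ be a metric structure, and let $h$ be a gauge metric field for $g$, i.e. $h$ is a non-singular smooth $(1,1)$-extensor field with $g=h^{\dagger}\circ\eta\circ h$, where $\eta$ is an orthogonal metric field with the same signature as $g$. Let $\mathbf{D}_a^{+}$ be the gauge (deformed) covariant derivative $\mathbf{D}_a^{+}X=\underline{h}(D_a^{+}\underline{h}^{-1}(X))$, where $D_a^{+}$ is the Levi-Civita $a$-directional covariant derivative of $g$. Then there exists a smooth $(1,2)$-extensor field $\Omega_0$ on $U$ such that for all $X\in\mathcal{M}(U)$ and all $a$ $$\mathbf{D}_a^{+}X=a\cdot\partial_oX+\Omega_0(a)\times_\eta X .$$ Such $\Omega_0$ is given by $$\Omega_0(a)=-\tfrac12\,\underline{\eta}(\partial_b\wedge\partial_c)\,[a,h^{-1}(b),h^{-1}(c)],$$ that is, $\Omega_0(a)=-\frac12\sum_{\mu,\nu}[a,h^{-1}(b_\mu),h^{-1}(b_\nu)]\;\eta(b_\mu)\wedge\eta(b_\nu)$.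
   Context: $M$ is an $n$-dimensional smooth manifold, $(U_o,\phi_o)$ a chart with coordinates $x^1,\dots,x^n$, and $U\subset U_o$ open. The canonical space $\mathcal{U}_o$ is an $n$-dimensional real vector space with basis $b_1,\dots,b_n$ and the Euclidean scalar product $b_\mu\cdot b_\nu=\delta_{\mu\nu}$. $\mathcal{S}(U),\mathcal{V}(U),\mathcal{M}(U)$ denote smooth maps from $U$ to $\mathbb{R},\mathcal{U}_o,\bigwedge\mathcal{U}_o$. For $a\in\mathcal{U}_o$ (or pointwise for $a\in\mathcal V(U)$), $a\cdot\partial_o X=\sum_\mu(a\cdot b_\mu)\,\partial X/\partial x^\mu$ (componentwise); for an endomorphism field $g$, $(a\cdot\partial_og)(b)=a\cdot\partial_o(g(b))-g(a\cdot\partial_ob)$. $[a,b]=a\cdot\partial_ob-b\cdot\partial_oa$ for vector fields. $v\lrcorner X$ is the Euclidean interior product by a vector $v$. A smooth $(1,1)$- (resp. $(1,2)$-) extensor field is a smooth field of linear maps $\mathcal{U}_o\to\mathcal{U}_o$ (resp. $\mathcal{U}_o\to\bigwedge^2\mathcal{U}_o$). ${}^\dagger$ is the Euclidean adjoint; $\underline t$ is the exterior-algebra extension of $t$. Metric field: smooth $(1,1)$-extensor field $g$ on $U$ with $g=g^\dagger$, $\det[g]\neq0$; the pair $(U,g)$ is then called a metric structure. Orthogonal metric field: metric field $\eta$ with $\eta=\eta^\dagger=\eta^{-1}$. $v\cdot_gw=g(v)\cdot w$. For $m=g$ or $\eta$, a bivector $B$ and multivector $X$, $B\times_mX$ is half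 the commutator in the $m$-Clifford algebra; for vectors $B\times_mb=-m(b)\lrcorner B$, and in general $B\times_mX=\sum_\mu(B\times_mb_\mu)\wedge(b_\mu\lrcorner X)$. Levi-Civita connection field: $\lambda_a(b)=\frac12g^{-1}\circ(a\cdot\partial_og)(b)+\omega_0(a)\times_gb$ with $\omega_0(a)=-\frac14\sum_{\mu,\nu}a\cdot((b_\mu\cdot\partial_og)(b_\nu)-(b_\nu\cdot\partial_og)(b_\mu))\,g^{-1}(b_\mu)\wedge g^{-1}(b_\nu)$; $\Lambda_a(X)=\sum_\mu\lambda_a(b_\mu)\wedge(b_\mu\lrcorner X)$; $D_a^{+}X=a\cdot\partial_oX+\Lambda_a(X)$. Christoffel operator of first kind, for vector fields $a,b,c$: $[a,b,c]=\frac12(a\cdot\partial_o(b\cdot_gc)+b\cdot\partial_o(c\cdot_ga)-c\cdot\partial_o(a\cdot_gb)+c\cdot_g[a,b]+b\cdot_g[c,a]-a\cdot_g[b,c])$. The symbols $\partial_b,\partial_c$ denote derivatives with respect to the vector variables $b,c\in\mathcal{U}_o$: $\partial_b\ast F(b)=\sum_\mu b_\mu\ast F(b_\mu)$ for $F$ linear in $b\in\mathcal{U}_o$.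
   Formalization: The formal theorem assumes in addition that the orthogonal metric field η is locally constant on U (a·∂ₒη = 0); for varying η no Ω₀ exists (e.g. g = η a rotating reflection, h = id), and this condition is in fact necessary. *)

theory Defs
  imports "HOL-Analysis.Analysis"
begin

section \<open>Charts and smooth fields\<close>

text \<open>
  The canonical space is \<open>'n uvec\<close>, with its standard basis and inner product.  A chart is
  the pair of its domain and its coordinate map.  Coordinate maps and fields are total functions;
  only their values on the domain matter.
\<close>

type_synonym 'n uvec = "real ^ 'n"

type_synonym ('m, 'n) chart = "'m set \<times> ('m \<Rightarrow> 'n uvec)"

definition chart_inv :: "('m, 'n) chart \<Rightarrow> 'n uvec \<Rightarrow> 'm"
  where "chart_inv \<kappa> = inv_into (fst \<kappa>) (snd \<kappa>)"

definition is_chart :: "('m::topological_space, 'n::finite) chart \<Rightarrow> bool"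
  where "is_chart \<kappa> \<longleftrightarrow> open (fst \<kappa>) \<and> open (snd \<kappa> ` fst \<kappa>) \<and>
    homeomorphism (fst \<kappa>) (snd \<kappa> ` fst \<kappa>) (snd \<kappa>) (chart_inv \<kappa>)"

text \<open>\<open>Ck_on S k f\<close>: \<open>f\<close> is of class \<open>C\<^sup>k\<close> on \<open>S\<close>; only meant for open sets \<open>S\<close>.\<close>

primrec Ck_on :: "'n::finite uvec set \<Rightarrow> nat \<Rightarrow> ('n uvec \<Rightarrow> 'b::real_normed_vector) \<Rightarrow> bool"
  where
    "Ck_on S 0 f = continuous_on S f"
  | "Ck_on S (Suc k) f = ((\<forall>x\<in>S. f differentiable at x) \<and>
       (\<forall>v. Ck_on S k (\<lambda>x. frechet_derivative f (at x) v)))"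

definition smooth_on :: "'n::finite uvec set \<Rightarrow> ('n uvec \<Rightarrow> 'b::real_normed_vector) \<Rightarrow> bool"
  where "smooth_on S f \<longleftrightarrow> (\<forall>k. Ck_on S k f)"

definition smooth_atlas :: "('m::topological_space, 'n::finite) chart set \<Rightarrow> bool"
  where "smooth_atlas \<A> \<longleftrightarrow> (\<Union>\<kappa>\<in>\<A>. fst \<kappa>) = UNIV \<and> (\<forall>\<kappa>\<in>\<A>. is_chart \<kappa>) \<and>
    (\<forall>\<kappa>\<in>\<A>. \<forall>\<kappa>'\<in>\<A>. smooth_on (snd \<kappa> ` (fst \<kappa> \<inter> fst \<kappa>')) (snd \<kappa>' \<circ> chart_inv \<kappa>))"

text \<open>
  A map on an open subset \<open>U\<close> of the chart domain is smooth iff its coordinate expression is.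
  With value type \<open>real\<close>, \<open>'n uvec\<close> and \<open>'n mv\<close> (below) this gives the three spaces
  \<open>\<S>(U)\<close>, \<open>\<V>(U)\<close> and \<open>\<M>(U)\<close>.
\<close>

definition smooth_field ::
    "('m, 'n::finite) chart \<Rightarrow> 'm set \<Rightarrow> ('m \<Rightarrow> 'b::real_normed_vector) \<Rightarrow> bool"
  where "smooth_field \<kappa> U X \<longleftrightarrow> smooth_on (snd \<kappa> ` U) (X \<circ> chart_inv \<kappa>)"


section \<open>The exterior algebra of the canonical space\<close>

text \<open>
  A multivector is the family of its coefficients: index \<open>A\<close> belongs to the basis blade
  \<open>b\<^bsub>i1\<^esub> \<and> \<dots> \<and> b\<^bsub>ik\<^esub>\<close> with \<open>A = {i1 < \<dots> < ik}\<close>.  The linear order of the index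
  type serves only to fix the signs of these blades.
\<close>

type_synonym 'n mv = "real ^ ('n set)"

abbreviation bas :: "'n::finite \<Rightarrow> 'n uvec"
  where "bas \<mu> \<equiv> axis \<mu> 1"

definition mv_one :: "'n::finite mv"
  where "mv_one = axis {} 1"

definition mv_vec :: "'n::finite uvec \<Rightarrow> 'n mv"
  where "mv_vec v = (\<Sum>i\<in>UNIV. (v $ i) *\<^sub>R axis {i} 1)"

definition bivector :: "'n::finite mv \<Rightarrow> bool"
  where "bivector B \<longleftrightarrow> (\<forall>A. card A \<noteq> 2 \<longrightarrow> B $ A = 0)"

definition blade_sign :: "'n::{finite,linorder} set \<Rightarrow> 'n set \<Rightarrow> real"
  where "blade_sign A B = (-1) ^ card {(i, j). i \<in> A \<and> j \<in> B \<and> j < i}"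

definition wedge :: "'n::{finite,linorder} mv \<Rightarrow> 'n mv \<Rightarrow> 'n mv"  (infixr \<open>\<and>\<^sub>m\<close> 72)
  where "X \<and>\<^sub>m Y = (\<chi> C. \<Sum>A\<in>Pow C. blade_sign A (C - A) * X $ A * Y $ (C - A))"

definition lcontr :: "'n::{finite,linorder} uvec \<Rightarrow> 'n mv \<Rightarrow> 'n mv"  (infixr \<open>\<rfloor>\<^sub>m\<close> 72)
  where "v \<rfloor>\<^sub>m X = (\<chi> A. \<Sum>i\<in>- A. blade_sign {i} A * v $ i * X $ (insert i A))"

definition blade_map ::
    "('n::{finite,linorder} uvec \<Rightarrow> 'n uvec) \<Rightarrow> 'n list \<Rightarrow> 'n mv"
  where "blade_map t is = foldr (\<lambda>i Y. mv_vec (t (bas i)) \<and>\<^sub>m Y) is mv_one"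

text \<open>The extension of a linear map \<open>t\<close> to the exterior algebra.\<close>

definition mv_ext ::
    "('n::{finite,linorder} uvec \<Rightarrow> 'n uvec) \<Rightarrow> 'n mv \<Rightarrow> 'n mv"
  where "mv_ext t X = (\<Sum>A\<in>UNIV. (X $ A) *\<^sub>R blade_map t (sorted_list_of_set A))"


section \<open>The \<open>m\<close>-Clifford algebra\<close>

text \<open>
  The product of the \<open>m\<close>-Clifford algebra (for a symmetric linear map \<open>m\<close>) on the exterior
  algebra is the associative one with unit \<open>1\<close> and \<open>b X = b \<and> X + m(b) \<rfloor> X\<close> for vectors \<open>b\<close>.
  So \<open>(b \<and> Z) Y = b (Z Y) - (m(b) \<rfloor> Z) Y\<close>; the recursion for the left action of the basis
  blade of an index list is this identity, the contraction being expanded along the list.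
\<close>

function blade_clifford ::
    "('n::{finite,linorder} uvec \<Rightarrow> 'n uvec) \<Rightarrow> 'n list \<Rightarrow> 'n mv \<Rightarrow> 'n mv"
  where
    "blade_clifford m [] Y = Y"
  | "blade_clifford m (i # is) Y =
       mv_vec (bas i) \<and>\<^sub>m blade_clifford m is Y + m (bas i) \<rfloor>\<^sub>m blade_clifford m is Y
       - (\<Sum>k<length is. ((-1) ^ k * (m (bas i) \<bullet> bas (is ! k))) *\<^sub>R
            blade_clifford m (take k is @ drop (Suc k) is) Y)"
  by pat_completeness auto
termination
  by (relation "Wellfounded.measure (\<lambda>(m, is, Y). length is)") auto

definition clifford ::
    "('n::{finite,linorder} uvec \<Rightarrow> 'n uvec) \<Rightarrow> 'n mv \<Rightarrow> 'n mv \<Rightarrow> 'n mv"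
  where "clifford m X Y = (\<Sum>A\<in>UNIV. (X $ A) *\<^sub>R blade_clifford m (sorted_list_of_set A) Y)"

lemma clifford_one_left: "clifford m mv_one Y = Y"
proof -
  have "clifford m mv_one Y =
      (\<Sum>A\<in>UNIV. if A = {} then blade_clifford m (sorted_list_of_set A) Y else 0)"
    unfolding clifford_def mv_one_def by (intro sum.cong) (auto simp: axis_def)
  then show ?thesis by simp
qed

lemma clifford_vec_left:
  assumes "linear m"
  shows "clifford m (mv_vec v) Y = mv_vec v \<and>\<^sub>m Y + m v \<rfloor>\<^sub>m Y"
proof -
  have wadd: "linear (\<lambda>x. mv_vec x \<and>\<^sub>m Y)"
    by (rule linearI)
      (simp_all add: vec_eq_iff wedge_def mv_vec_def sum.distrib sum_distrib_left algebra_simps)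
  have ladd: "linear (\<lambda>x. x \<rfloor>\<^sub>m Y)"
    by (rule linearI)
      (simp_all add: vec_eq_iff lcontr_def sum.distrib sum_distrib_left algebra_simps)
  have lin: "linear (\<lambda>x. mv_vec x \<and>\<^sub>m Y + m x \<rfloor>\<^sub>m Y)"
    using linear_compose_add[OF wadd linear_compose[OF assms ladd]] by (simp add: o_def)
  have coeff: "mv_vec v $ A = (\<Sum>i\<in>UNIV. if A = {i} then v $ i else 0)" for A
    unfolding mv_vec_def by (auto simp: axis_def intro!: sum.cong)
  have "clifford m (mv_vec v) Y = (\<Sum>A\<in>UNIV. \<Sum>i\<in>UNIV.
      if A = {i} then v $ i *\<^sub>R blade_clifford m [i] Y else 0)"
    unfolding clifford_def coeff scaleR_left.sum by (intro sum.cong) auto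
  also have "\<dots> = (\<Sum>i\<in>UNIV. v $ i *\<^sub>R (mv_vec (bas i) \<and>\<^sub>m Y + m (bas i) \<rfloor>\<^sub>m Y))"
    by (subst sum.swap) simp
  also have "\<dots> = mv_vec (\<Sum>i\<in>UNIV. v $ i *\<^sub>R bas i) \<and>\<^sub>m Y + m (\<Sum>i\<in>UNIV. v $ i *\<^sub>R bas i) \<rfloor>\<^sub>m Y"
    by (simp only: linear_sum[OF lin] linear_cmul[OF lin])
  finally show ?thesis
    using basis_expansion[of v] by (simp add: scalar_mult_eq_scaleR)
qed

definition comm_prod ::
    "('n::{finite,linorder} uvec \<Rightarrow> 'n uvec) \<Rightarrow> 'n mv \<Rightarrow> 'n mv \<Rightarrow> 'n mv"
  where "comm_prod m X Y = (1/2) *\<^sub>R (clifford m X Y - clifford m Y X)"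


section \<open>Extensor fields and metric fields\<close>

definition extensor_field11 ::
    "('m, 'n::finite) chart \<Rightarrow> 'm set \<Rightarrow> ('m \<Rightarrow> 'n uvec \<Rightarrow> 'n uvec) \<Rightarrow> bool"
  where "extensor_field11 \<kappa> U t \<longleftrightarrow>
    (\<forall>p\<in>U. linear (t p)) \<and> (\<forall>v. smooth_field \<kappa> U (\<lambda>p. t p v))"

definition extensor_field12 ::
    "('m, 'n::finite) chart \<Rightarrow> 'm set \<Rightarrow> ('m \<Rightarrow> 'n uvec \<Rightarrow> 'n mv) \<Rightarrow> bool"
  where "extensor_field12 \<kappa> U t \<longleftrightarrow>
    (\<forall>p\<in>U. linear (t p) \<and> (\<forall>v. bivector (t p v))) \<and> (\<forall>v. smooth_field \<kappa> U (\<lambda>p. t p v))"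

definition metric_field ::
    "('m, 'n::finite) chart \<Rightarrow> 'm set \<Rightarrow> ('m \<Rightarrow> 'n uvec \<Rightarrow> 'n uvec) \<Rightarrow> bool"
  where "metric_field \<kappa> U g \<longleftrightarrow> extensor_field11 \<kappa> U g \<and>
    (\<forall>p\<in>U. g p = adjoint (g p) \<and> det (matrix (g p)) \<noteq> 0)"

text \<open>
  An orthogonal metric field may vary over \<open>U\<close>; that it is constant in the sense
  \<open>a \<cdot> \<partial>\<^sub>o \<eta> = 0\<close> is a separate assumption where needed.  A gauge derivative of the form
  \<open>a \<cdot> \<partial>\<^sub>o X + \<Omega>(a) \<times>\<^sub>\<eta> X\<close> forces it: for \<open>g = \<eta>\<close>, \<open>h = id\<close> the operator
  \<open>\<lambda>\<^sub>a = 1/2 \<eta>\<inverse> \<circ> (a \<cdot> \<partial>\<^sub>o \<eta>) + \<omega>\<^sub>0(a) \<times>\<^sub>\<eta> _\<close> is \<open>\<eta>\<close>-antisymmetric only if \<open>a \<cdot> \<partial>\<^sub>o \<eta> = 0\<close>.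
\<close>

definition orthogonal_metric_field ::
    "('m, 'n::finite) chart \<Rightarrow> 'm set \<Rightarrow> ('m \<Rightarrow> 'n uvec \<Rightarrow> 'n uvec) \<Rightarrow> bool"
  where "orthogonal_metric_field \<kappa> U \<eta> \<longleftrightarrow> metric_field \<kappa> U \<eta> \<and>
    (\<forall>p\<in>U. \<eta> p = adjoint (\<eta> p) \<and> adjoint (\<eta> p) = inv (\<eta> p))"

text \<open>
  The numbers of positive and of negative eigenvalues of a symmetric linear map, counted with
  multiplicity.
\<close>

definition signature :: "('n::finite uvec \<Rightarrow> 'n uvec) \<Rightarrow> nat \<times> nat"
  where "signature t =
    ((\<Sum>l \<in> {l. l > 0 \<and> (\<exists>v. v \<noteq> 0 \<and> t v = l *\<^sub>R v)}. dim {v. t v = l *\<^sub>R v}),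
     (\<Sum>l \<in> {l. l < 0 \<and> (\<exists>v. v \<noteq> 0 \<and> t v = l *\<^sub>R v)}. dim {v. t v = l *\<^sub>R v}))"

definition gauge_metric_field ::
    "('m, 'n::finite) chart \<Rightarrow> 'm set \<Rightarrow> ('m \<Rightarrow> 'n uvec \<Rightarrow> 'n uvec) \<Rightarrow>
     ('m \<Rightarrow> 'n uvec \<Rightarrow> 'n uvec) \<Rightarrow> ('m \<Rightarrow> 'n uvec \<Rightarrow> 'n uvec) \<Rightarrow> bool"
  where "gauge_metric_field \<kappa> U g \<eta> h \<longleftrightarrow>
    orthogonal_metric_field \<kappa> U \<eta> \<and> (\<forall>p\<in>U. signature (\<eta> p) = signature (g p)) \<and>
    extensor_field11 \<kappa> U h \<and> (\<forall>p\<in>U. det (matrix (h p)) \<noteq> 0) \<and>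
    (\<forall>p\<in>U. g p = adjoint (h p) \<circ> \<eta> p \<circ> h p)"


section \<open>Directional derivatives\<close>

definition coord_deriv ::
    "('m, 'n::finite) chart \<Rightarrow> 'n \<Rightarrow> ('m \<Rightarrow> 'b::real_normed_vector) \<Rightarrow> 'm \<Rightarrow> 'b"
  where "coord_deriv \<kappa> \<mu> X p =
    vector_derivative (\<lambda>s. X (chart_inv \<kappa> (snd \<kappa> p + s *\<^sub>R bas \<mu>))) (at 0)"

definition dir_deriv ::
    "('m, 'n::finite) chart \<Rightarrow> 'n uvec \<Rightarrow> ('m \<Rightarrow> 'b::real_normed_vector) \<Rightarrow> 'm \<Rightarrow> 'b"
  where "dir_deriv \<kappa> a X p = (\<Sum>\<mu>\<in>UNIV. (a \<bullet> bas \<mu>) *\<^sub>R coord_deriv \<kappa> \<mu> X p)"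

text \<open>\<open>(a \<cdot> \<partial>\<^sub>o g)(b)\<close> for a fixed vector \<open>b\<close>.\<close>

definition dir_deriv_ext ::
    "('m, 'n::finite) chart \<Rightarrow> 'n uvec \<Rightarrow> ('m \<Rightarrow> 'n uvec \<Rightarrow> 'n uvec) \<Rightarrow> 'n uvec \<Rightarrow>
     'm \<Rightarrow> 'n uvec"
  where "dir_deriv_ext \<kappa> a g b p =
    dir_deriv \<kappa> a (\<lambda>q. g q b) p - g p (dir_deriv \<kappa> a (\<lambda>q. b) p)"

definition lie_bracket ::
    "('m, 'n::finite) chart \<Rightarrow> ('m \<Rightarrow> 'n uvec) \<Rightarrow> ('m \<Rightarrow> 'n uvec) \<Rightarrow> 'm \<Rightarrow> 'n uvec"
  where "lie_bracket \<kappa> a b p = dir_deriv \<kappa> (a p) b p - dir_deriv \<kappa> (b p) a p"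

definition metric_prod ::
    "('m \<Rightarrow> 'n::finite uvec \<Rightarrow> 'n uvec) \<Rightarrow> ('m \<Rightarrow> 'n uvec) \<Rightarrow> ('m \<Rightarrow> 'n uvec) \<Rightarrow> 'm \<Rightarrow> real"
  where "metric_prod g v w p = g p (v p) \<bullet> w p"

definition christoffel1 ::
    "('m, 'n::finite) chart \<Rightarrow> ('m \<Rightarrow> 'n uvec \<Rightarrow> 'n uvec) \<Rightarrow>
     ('m \<Rightarrow> 'n uvec) \<Rightarrow> ('m \<Rightarrow> 'n uvec) \<Rightarrow> ('m \<Rightarrow> 'n uvec) \<Rightarrow> 'm \<Rightarrow> real"
  where "christoffel1 \<kappa> g a b c p = (1/2) *
    (dir_deriv \<kappa> (a p) (metric_prod g b c) p
     + dir_deriv \<kappa> (b p) (metric_prod g c a) p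
     - dir_deriv \<kappa> (c p) (metric_prod g a b) p
     + metric_prod g c (lie_bracket \<kappa> a b) p
     + metric_prod g b (lie_bracket \<kappa> c a) p
     - metric_prod g a (lie_bracket \<kappa> b c) p)"


section \<open>Levi-Civita and gauge covariant derivatives\<close>

definition lc_omega ::
    "('m, 'n::{finite,linorder}) chart \<Rightarrow> ('m \<Rightarrow> 'n uvec \<Rightarrow> 'n uvec) \<Rightarrow> 'm \<Rightarrow> 'n uvec \<Rightarrow> 'n mv"
  where "lc_omega \<kappa> g p a = - (1/4) *\<^sub>R (\<Sum>\<mu>\<in>UNIV. \<Sum>\<nu>\<in>UNIV.
    (a \<bullet> (dir_deriv_ext \<kappa> (bas \<mu>) g (bas \<nu>) p - dir_deriv_ext \<kappa> (bas \<nu>) g (bas \<mu>) p)) *\<^sub>R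
      (mv_vec (inv (g p) (bas \<mu>)) \<and>\<^sub>m mv_vec (inv (g p) (bas \<nu>))))"

text \<open>The vector \<open>\<lambda>\<^sub>a(b)\<close>, taken as a multivector of grade one.\<close>

definition lc_lambda ::
    "('m, 'n::{finite,linorder}) chart \<Rightarrow> ('m \<Rightarrow> 'n uvec \<Rightarrow> 'n uvec) \<Rightarrow> 'm \<Rightarrow> 'n uvec \<Rightarrow>
     'n uvec \<Rightarrow> 'n mv"
  where "lc_lambda \<kappa> g p a b =
    mv_vec ((1/2) *\<^sub>R inv (g p) (dir_deriv_ext \<kappa> a g b p))
    + comm_prod (g p) (lc_omega \<kappa> g p a) (mv_vec b)"

definition lc_Lambda ::
    "('m, 'n::{finite,linorder}) chart \<Rightarrow> ('m \<Rightarrow> 'n uvec \<Rightarrow> 'n uvec) \<Rightarrow> 'm \<Rightarrow> 'n uvec \<Rightarrow>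
     'n mv \<Rightarrow> 'n mv"
  where "lc_Lambda \<kappa> g p a X = (\<Sum>\<mu>\<in>UNIV. lc_lambda \<kappa> g p a (bas \<mu>) \<and>\<^sub>m (bas \<mu> \<rfloor>\<^sub>m X))"

definition lc_deriv ::
    "('m, 'n::{finite,linorder}) chart \<Rightarrow> ('m \<Rightarrow> 'n uvec \<Rightarrow> 'n uvec) \<Rightarrow> 'n uvec \<Rightarrow>
     ('m \<Rightarrow> 'n mv) \<Rightarrow> 'm \<Rightarrow> 'n mv"
  where "lc_deriv \<kappa> g a X p = dir_deriv \<kappa> a X p + lc_Lambda \<kappa> g p a (X p)"

definition gauge_deriv ::
    "('m, 'n::{finite,linorder}) chart \<Rightarrow> ('m \<Rightarrow> 'n uvec \<Rightarrow> 'n uvec) \<Rightarrow>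
     ('m \<Rightarrow> 'n uvec \<Rightarrow> 'n uvec) \<Rightarrow> 'n uvec \<Rightarrow> ('m \<Rightarrow> 'n mv) \<Rightarrow> 'm \<Rightarrow> 'n mv"
  where "gauge_deriv \<kappa> g h a X p =
    mv_ext (h p) (lc_deriv \<kappa> g a (\<lambda>q. mv_ext (inv (h q)) (X q)) p)"

text \<open>
  \<open>gauge_connection \<kappa> U g \<eta> h \<Omega>\<close>: \<open>\<Omega>\<close> is a smooth extensor field with
  \<open>\<^bold>D\<^sub>a X = a \<cdot> \<partial>\<^sub>o X + \<Omega>(a) \<times>\<^sub>\<eta> X\<close> on \<open>U\<close>.  Here \<open>a\<close> runs through the smooth vector fields, which
  include the constant ones.
\<close>

definition gauge_connection ::
    "('m, 'n::{finite,linorder}) chart \<Rightarrow> 'm set \<Rightarrow> ('m \<Rightarrow> 'n uvec \<Rightarrow> 'n uvec) \<Rightarrow>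
     ('m \<Rightarrow> 'n uvec \<Rightarrow> 'n uvec) \<Rightarrow> ('m \<Rightarrow> 'n uvec \<Rightarrow> 'n uvec) \<Rightarrow>
     ('m \<Rightarrow> 'n uvec \<Rightarrow> 'n mv) \<Rightarrow> bool"
  where "gauge_connection \<kappa> U g \<eta> h \<Omega> \<longleftrightarrow> extensor_field12 \<kappa> U \<Omega> \<and>
    (\<forall>X a. smooth_field \<kappa> U X \<longrightarrow> smooth_field \<kappa> U a \<longrightarrow>
      (\<forall>p\<in>U. gauge_deriv \<kappa> g h (a p) X p =
        dir_deriv \<kappa> (a p) X p + comm_prod (\<eta> p) (\<Omega> p (a p)) (X p)))"

end

theory Submission
  imports Defs
begin

text \<open>
  On the extension of \<open>h\<inverse>\<close> to multivectors, both the derivative \<open>a \<cdot> \<partial>\<^sub>o\<close> and \<open>\<Lambda>\<^sub>a\<close> act through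
  derivations of the exterior algebra, so conjugation by \<open>h\<close> gives
  \<open>\<^bold>D\<^sub>a X = a \<cdot> \<partial>\<^sub>o X + M\<^sub>a X\<close>, where the derivation \<open>M\<^sub>a\<close> extends the linear map
  \<open>b \<mapsto> h(D\<^sub>a (h\<inverse>(b)))\<close> of vectors.  By the Koszul formula
  \<open>\<eta>(M\<^sub>a b) \<cdot> c = g(D\<^sub>a (h\<inverse>(b))) \<cdot> h\<inverse>(c) = [a, h\<inverse>(b), h\<inverse>(c)]\<close>, and metric compatibility makes this
  antisymmetric in \<open>b, c\<close>, because \<open>g(h\<inverse>(b)) \<cdot> h\<inverse>(c) = \<eta>(b) \<cdot> c\<close> is constant.  An
  \<open>\<eta>\<close>-antisymmetric derivation is the commutator product with exactly one bivector: in the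
  \<open>m\<close>-Clifford algebra, \<open>(u \<and> w) \<times>\<^sub>m X = u \<and> (m(w) \<rfloor> X) - w \<and> (m(u) \<rfloor> X)\<close>.
\<close>

section \<open>Wedge product and contraction\<close>

text \<open>Multivectors are coefficient families, so each sign rule is computed once for basis
  vectors, as a relation between the operators "wedge with a vector" and "contract with a vector",
  and then extended by linearity. The commutator is the obstacle. \<open>clifford\<close> is a
  recursion on its left factor, but in \<open>comm_prod\<close> the bivector also stands on the
  right, and its action there has to be characterised indirectly. The constant \<open>-1/2\<close>:
  put \<open>c \<mu> \<nu> = \<eta>(M\<^sub>a b\<^sub>\<mu>) \<bullet> b\<^sub>\<nu>\<close>. The
  plane formula, applied to the sum of all \<open>c \<mu> \<nu>\<close> times the plane of
  \<open>\<eta>(b\<^sub>\<mu>)\<close> and \<open>\<eta>(b\<^sub>\<nu>)\<close>, yields two halves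
  that agree by antisymmetry of \<open>c\<close>. Contracting with
  \<open>\<eta>(\<eta>(b\<^sub>\<nu>)) = b\<^sub>\<nu>\<close> and exchanging the indices of
  \<open>c\<close> turns them into \<open>-2\<close> times the derivation of
  \<open>M\<^sub>a\<close>.\<close>

lemma mv_vec_bas: "mv_vec (bas i) = axis {i} 1"
proof -
  have "mv_vec (bas i) = (\<Sum>j\<in>UNIV. if j = i then axis {j} 1 else 0)"
    unfolding mv_vec_def by (intro sum.cong) (auto simp: axis_def)
  then show ?thesis by simp
qed

lemma linear_mv_vec: "linear mv_vec"
  by (rule linearI) (simp_all add: mv_vec_def sum.distrib scaleR_sum_right algebra_simps)

lemma linear_wedge_left: "linear (\<lambda>X. X \<and>\<^sub>m Y)"
  and linear_wedge_right: "linear (\<lambda>Y. X \<and>\<^sub>m Y)"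
  by (auto intro!: linearI simp: vec_eq_iff wedge_def sum.distrib sum_distrib_left algebra_simps)

lemma linear_lcontr_left: "linear (\<lambda>v. v \<rfloor>\<^sub>m Y)"
  and linear_lcontr_right: "linear (\<lambda>Y. v \<rfloor>\<^sub>m Y)"
  by (auto intro!: linearI simp: vec_eq_iff lcontr_def sum.distrib sum_distrib_left algebra_simps)

lemma bilinear_wedge: "bilinear (\<and>\<^sub>m)"
  unfolding bilinear_def by (intro conjI allI linear_wedge_left linear_wedge_right)

lemmas mv_vec_linear_simps =
  linear_add[OF linear_mv_vec] linear_diff[OF linear_mv_vec] linear_neg[OF linear_mv_vec]
  linear_cmul[OF linear_mv_vec] linear_0[OF linear_mv_vec] linear_sum[OF linear_mv_vec]

lemmas wedge_linear_simps =
  linear_add[OF linear_wedge_left] linear_add[OF linear_wedge_right]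
  linear_diff[OF linear_wedge_left] linear_diff[OF linear_wedge_right]
  linear_neg[OF linear_wedge_left] linear_neg[OF linear_wedge_right]
  linear_cmul[OF linear_wedge_left] linear_cmul[OF linear_wedge_right]
  linear_0[OF linear_wedge_left] linear_0[OF linear_wedge_right]
  linear_sum[OF linear_wedge_left] linear_sum[OF linear_wedge_right]

lemmas lcontr_linear_simps =
  linear_add[OF linear_lcontr_left] linear_add[OF linear_lcontr_right]
  linear_diff[OF linear_lcontr_left] linear_diff[OF linear_lcontr_right]
  linear_neg[OF linear_lcontr_left] linear_neg[OF linear_lcontr_right]
  linear_cmul[OF linear_lcontr_left] linear_cmul[OF linear_lcontr_right]
  linear_0[OF linear_lcontr_left] linear_0[OF linear_lcontr_right]
  linear_sum[OF linear_lcontr_left] linear_sum[OF linear_lcontr_right]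

lemma uvec_expansion: "(\<Sum>i\<in>UNIV. v $ i *\<^sub>R bas i) = (v :: 'n::finite uvec)"
  using basis_expansion[of v] by (simp add: scalar_mult_eq_scaleR)

lemma linear_eq_on_bas:
  fixes f g :: "'n::finite uvec \<Rightarrow> 'b::real_vector"
  assumes "linear f" "linear g" "\<And>i. f (bas i) = g (bas i)"
  shows "f = g"
proof
  fix v
  have "f (\<Sum>i\<in>UNIV. v $ i *\<^sub>R bas i) = g (\<Sum>i\<in>UNIV. v $ i *\<^sub>R bas i)"
    by (simp only: linear_sum[OF assms(1)] linear_sum[OF assms(2)]
        linear_cmul[OF assms(1)] linear_cmul[OF assms(2)] assms(3))
  then show "f v = g v" by (simp only: uvec_expansion)
qed

lemma blade_sign_empty: "blade_sign A {} = 1"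
  by (simp add: blade_sign_def)

lemma blade_sign_singleton: "blade_sign {i} A = (-1) ^ card {j\<in>A. j < i}"
proof -
  have "{(i', j). i' \<in> {i} \<and> j \<in> A \<and> j < i'} = Pair i ` {j\<in>A. j < i}" by auto
  moreover have "card (Pair i ` {j\<in>A. j < i}) = card {j\<in>A. j < i}"
    by (intro card_image) (simp add: inj_on_def)
  ultimately show ?thesis by (simp add: blade_sign_def)
qed

lemma blade_sign_insert:
  fixes A :: "'n::{finite,linorder} set"
  assumes "j \<notin> A"
  shows "blade_sign {i} (insert j A) = (if j < i then - 1 else 1) * blade_sign {i} A"
proof (cases "j < i")
  case True
  then have "{k \<in> insert j A. k < i} = insert j {k\<in>A. k < i}" by auto
  with True assms show ?thesis by (simp add: blade_sign_singleton)
next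
  case False
  then have "{k \<in> insert j A. k < i} = {k\<in>A. k < i}" by auto
  with False show ?thesis by (simp add: blade_sign_singleton)
qed

lemma blade_sign_cancel: "blade_sign A B * (blade_sign A B * y) = y"
  by (simp add: blade_sign_def flip: power_add mult.assoc)

lemma bas_wedge_nth:
  "(mv_vec (bas i) \<and>\<^sub>m Y) $ C = (if i \<in> C then blade_sign {i} (C - {i}) * Y $ (C - {i}) else 0)"
proof -
  have "(mv_vec (bas i) \<and>\<^sub>m Y) $ C =
      (\<Sum>A\<in>Pow C. if A = {i} then blade_sign A (C - A) * Y $ (C - A) else 0)"
    unfolding mv_vec_bas wedge_def vec_lambda_beta by (intro sum.cong) (auto simp: axis_def)
  then show ?thesis by simp
qed

lemma bas_lcontr_nth:
  "(bas i \<rfloor>\<^sub>m X) $ A = (if i \<in> A then 0 else blade_sign {i} A * X $ insert i A)"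
proof -
  have "(bas i \<rfloor>\<^sub>m X) $ A = (\<Sum>j\<in>- A. if j = i then blade_sign {j} A * X $ insert j A else 0)"
    unfolding lcontr_def vec_lambda_beta by (intro sum.cong) (auto simp: axis_def)
  then show ?thesis by simp
qed

text \<open>Both coefficients at \<open>C\<close> vanish unless \<open>i\<close> and
  \<open>j\<close> are distinct members of \<open>C\<close>. Otherwise both orders remove the same
  two indices, and exactly one of them sees the inversion between \<open>i\<close> and
  \<open>j\<close>.\<close>

lemma bas_wedge_anticommute:
  "mv_vec (bas i) \<and>\<^sub>m mv_vec (bas j) \<and>\<^sub>m Y = - (mv_vec (bas j) \<and>\<^sub>m mv_vec (bas i) \<and>\<^sub>m Y)"
proof -
  have "(mv_vec (bas i) \<and>\<^sub>m mv_vec (bas j) \<and>\<^sub>m Y) $ C =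
    - (mv_vec (bas j) \<and>\<^sub>m mv_vec (bas i) \<and>\<^sub>m Y) $ C" for C
  proof (cases "i \<in> C \<and> j \<in> C \<and> i \<noteq> j")
    case True
    define D where "D = C - {i} - {j}"
    from True have n: "i \<notin> D" "j \<notin> D" and
      S: "C - {i} = insert j D" "C - {j} = insert i D" "insert j D - {j} = D" "insert i D - {i} = D"
      by (auto simp: D_def)
    show ?thesis
      by (cases i j rule: linorder_cases) (use True in \<open>simp_all add: bas_wedge_nth
          blade_sign_insert S n\<close>)
  qed (auto simp: bas_wedge_nth)
  then show ?thesis by (simp add: vec_eq_iff)
qed

lemma bas_lcontr_anticommute:
  "bas i \<rfloor>\<^sub>m bas j \<rfloor>\<^sub>m Y = - (bas j \<rfloor>\<^sub>m bas i \<rfloor>\<^sub>m Y)"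
proof -
  have "(bas i \<rfloor>\<^sub>m bas j \<rfloor>\<^sub>m Y) $ C = - (bas j \<rfloor>\<^sub>m bas i \<rfloor>\<^sub>m Y) $ C" for C
    by (auto simp: bas_lcontr_nth blade_sign_insert insert_commute)
  then show ?thesis by (simp add: vec_eq_iff)
qed

text \<open>The canonical anticommutation relation. For \<open>i = j\<close>, exactly one of the two
  operator orders is active at each \<open>C\<close>, depending on whether \<open>i \<in> C\<close>.
  For distinct indices both orders reach the same coefficient, with signs differing by the inversion
  between \<open>i\<close> and \<open>j\<close>.\<close>

lemma bas_lcontr_wedge:
  "bas i \<rfloor>\<^sub>m (mv_vec (bas j) \<and>\<^sub>m Y) = (bas i \<bullet> bas j) *\<^sub>R Y - mv_vec (bas j) \<and>\<^sub>m (bas i \<rfloor>\<^sub>m Y)"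
proof -
  have "(bas i \<rfloor>\<^sub>m (mv_vec (bas j) \<and>\<^sub>m Y)) $ C =
    (bas i \<bullet> bas j) * Y $ C - (mv_vec (bas j) \<and>\<^sub>m (bas i \<rfloor>\<^sub>m Y)) $ C" for C
  proof (cases "i = j")
    case True
    show ?thesis
    proof (cases "i \<in> C")
      case iC: True
      then have "insert i (C - {i}) = C" by auto
      with True iC show ?thesis
        by (simp add: bas_wedge_nth bas_lcontr_nth inner_axis_axis blade_sign_cancel)
    next
      case iC: False
      then have "insert i C - {i} = C" by auto
      with True iC show ?thesis
        by (simp add: bas_wedge_nth bas_lcontr_nth inner_axis_axis blade_sign_cancel)
    qed
  next
    case False
    show ?thesis
    proof (cases "i \<notin> C \<and> j \<in> C")
      case True
      define D where "D = C - {j}"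
      have C: "j \<notin> D" "i \<notin> D" "C = insert j D"
        and S: "insert i (insert j D) - {j} = insert i D" "insert j D - {j} = D"
        using True False by (auto simp: D_def)
      show ?thesis
        unfolding C(3) by (cases i j rule: linorder_cases)
          (use C(1,2) False in \<open>simp_all add: bas_wedge_nth bas_lcontr_nth inner_axis_axis
              blade_sign_insert S\<close>)
    qed (use False in \<open>auto simp: bas_wedge_nth bas_lcontr_nth inner_axis_axis\<close>)
  qed
  then show ?thesis by (simp add: vec_eq_iff)
qed

lemma vec_wedge_anticommute:
  "mv_vec u \<and>\<^sub>m mv_vec v \<and>\<^sub>m Y = - (mv_vec v \<and>\<^sub>m mv_vec u \<and>\<^sub>m Y)"
proof -
  \<comment> \<open>Linearity is used in one slot at a time: first in \<open>v\<close> against a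
    basis vector, then in \<open>u\<close>.\<close>
  have *: "(\<lambda>v. mv_vec (bas i) \<and>\<^sub>m mv_vec v \<and>\<^sub>m Y) = (\<lambda>v. - (mv_vec v \<and>\<^sub>m mv_vec (bas i) \<and>\<^sub>m Y))"
      for i
    by (rule linear_eq_on_bas)
      (auto intro!: linearI simp: mv_vec_linear_simps wedge_linear_simps scaleR_right_distrib
        intro: bas_wedge_anticommute)
  have "mv_vec (bas i) \<and>\<^sub>m mv_vec v \<and>\<^sub>m Y = - (mv_vec v \<and>\<^sub>m mv_vec (bas i) \<and>\<^sub>m Y)" for i v
    using fun_cong[OF *, of i v] .
  then have **: "(\<lambda>u. mv_vec u \<and>\<^sub>m mv_vec v \<and>\<^sub>m Y) = (\<lambda>u. - (mv_vec v \<and>\<^sub>m mv_vec u \<and>\<^sub>m Y))"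
    by (intro linear_eq_on_bas)
      (auto intro!: linearI simp: mv_vec_linear_simps wedge_linear_simps scaleR_right_distrib)
  show ?thesis using fun_cong[OF **, of u] .
qed

lemma lcontr_anticommute: "u \<rfloor>\<^sub>m v \<rfloor>\<^sub>m Y = - (v \<rfloor>\<^sub>m u \<rfloor>\<^sub>m Y)"
proof -
  have *: "(\<lambda>v. bas i \<rfloor>\<^sub>m v \<rfloor>\<^sub>m Y) = (\<lambda>v. - (v \<rfloor>\<^sub>m bas i \<rfloor>\<^sub>m Y))" for i
    by (rule linear_eq_on_bas)
      (auto intro!: linearI simp: lcontr_linear_simps scaleR_right_distrib
        intro: bas_lcontr_anticommute)
  have "bas i \<rfloor>\<^sub>m v \<rfloor>\<^sub>m Y = - (v \<rfloor>\<^sub>m bas i \<rfloor>\<^sub>m Y)" for i v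
    using fun_cong[OF *, of i v] .
  then have **: "(\<lambda>u. u \<rfloor>\<^sub>m v \<rfloor>\<^sub>m Y) = (\<lambda>u. - (v \<rfloor>\<^sub>m u \<rfloor>\<^sub>m Y))"
    by (intro linear_eq_on_bas)
      (auto intro!: linearI simp: lcontr_linear_simps scaleR_right_distrib)
  show ?thesis using fun_cong[OF **, of u] .
qed

lemma lcontr_wedge:
  "v \<rfloor>\<^sub>m (mv_vec u \<and>\<^sub>m Y) = (v \<bullet> u) *\<^sub>R Y - mv_vec u \<and>\<^sub>m (v \<rfloor>\<^sub>m Y)"
proof -
  have *: "(\<lambda>u. bas i \<rfloor>\<^sub>m (mv_vec u \<and>\<^sub>m Y)) =
      (\<lambda>u. (bas i \<bullet> u) *\<^sub>R Y - mv_vec u \<and>\<^sub>m (bas i \<rfloor>\<^sub>m Y))" for i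
    by (rule linear_eq_on_bas)
      (auto intro!: linearI simp: mv_vec_linear_simps lcontr_linear_simps wedge_linear_simps
        inner_add_right algebra_simps bas_lcontr_wedge)
  have "bas i \<rfloor>\<^sub>m (mv_vec u \<and>\<^sub>m Y) = (bas i \<bullet> u) *\<^sub>R Y - mv_vec u \<and>\<^sub>m (bas i \<rfloor>\<^sub>m Y)" for i u
    using fun_cong[OF *, of i u] .
  then have **: "(\<lambda>v. v \<rfloor>\<^sub>m (mv_vec u \<and>\<^sub>m Y)) = (\<lambda>v. (v \<bullet> u) *\<^sub>R Y - mv_vec u \<and>\<^sub>m (v \<rfloor>\<^sub>m Y))"
    by (intro linear_eq_on_bas)
      (auto intro!: linearI simp: mv_vec_linear_simps lcontr_linear_simps wedge_linear_simps
        inner_add_left algebra_simps)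
  show ?thesis using fun_cong[OF **, of v] .
qed

lemma vec_wedge_same: "mv_vec u \<and>\<^sub>m mv_vec u \<and>\<^sub>m Y = 0"
  using vec_wedge_anticommute[of u u Y] by (simp add: vec_eq_iff)

lemma wedge_one: "X \<and>\<^sub>m mv_one = X"
proof -
  have "(X \<and>\<^sub>m mv_one) $ C = (\<Sum>A\<in>Pow C. if A = C then X $ A else 0)" for C
    unfolding wedge_def mv_one_def vec_lambda_beta
  proof (intro sum.cong refl)
    fix A assume "A \<in> Pow C"
    then have "C - A = {} \<longleftrightarrow> A = C" by auto
    then show "blade_sign A (C - A) * X $ A * axis {} 1 $ (C - A) = (if A = C then X $ A else 0)"
      by (auto simp: axis_def blade_sign_empty)
  qed
  then show ?thesis by (simp add: vec_eq_iff)
qed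

lemma lcontr_one: "v \<rfloor>\<^sub>m mv_one = 0"
  by (simp add: vec_eq_iff lcontr_def mv_one_def axis_def)

lemma lcontr_vec: "v \<rfloor>\<^sub>m mv_vec u = (v \<bullet> u) *\<^sub>R mv_one"
  using lcontr_wedge[of v u mv_one] by (simp add: wedge_one lcontr_one wedge_linear_simps)

section \<open>Blades and induction over index sets\<close>

lemma bas_wedge_axis:
  "mv_vec (bas i) \<and>\<^sub>m axis A 1 = (if i \<in> A then 0 else blade_sign {i} A *\<^sub>R axis (insert i A) 1)"
  unfolding vec_eq_iff bas_wedge_nth by (auto simp: axis_def)

lemma blade_sign_min: "\<forall>j\<in>A. i < j \<Longrightarrow> blade_sign {i} A = 1"
proof -
  assume "\<forall>j\<in>A. i < j"
  then have "{j \<in> A. j < i} = {}" by fastforce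
  then show ?thesis by (simp only: blade_sign_singleton card.empty power_0)
qed

text \<open>Wedging an index below all of \<open>A\<close> from the left costs no sign, so sorted
  blades grow at their left end. This is why the inductions on index sets add a least
  element.\<close>

lemma axis_insert_min:
  "\<forall>j\<in>A. i < j \<Longrightarrow> axis (insert i A) 1 = mv_vec (bas i) \<and>\<^sub>m axis A 1"
  using bas_wedge_axis[of i A] blade_sign_min[of A i] by auto

lemma mv_expansion: "(\<Sum>A\<in>UNIV. X $ A *\<^sub>R axis A 1) = (X :: 'n::finite mv)"
  using basis_expansion[of X] by (simp add: scalar_mult_eq_scaleR)

text \<open>Every blade arises from \<open>mv_one\<close> by wedging basis vectors on the left, and
  the blades span.\<close>

lemma linear_eq_on_mv:
  fixes f g :: "'n::{finite,linorder} mv \<Rightarrow> 'b::real_vector"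
  assumes "linear f" "linear g" "f mv_one = g mv_one"
    "\<And>i Y. f Y = g Y \<Longrightarrow> f (mv_vec (bas i) \<and>\<^sub>m Y) = g (mv_vec (bas i) \<and>\<^sub>m Y)"
  shows "f X = g X"
proof -
  have "f (axis A 1) = g (axis A 1)" for A
    by (rule finite_linorder_min_induct[OF finite[of A]])
      (use assms in \<open>auto simp: mv_one_def axis_insert_min\<close>)
  then have "f (\<Sum>A\<in>UNIV. X $ A *\<^sub>R axis A 1) = g (\<Sum>A\<in>UNIV. X $ A *\<^sub>R axis A 1)"
    by (simp only: linear_sum[OF assms(1)] linear_sum[OF assms(2)]
        linear_cmul[OF assms(1)] linear_cmul[OF assms(2)])
  then show ?thesis by (simp only: mv_expansion)
qed

section \<open>Extensions and derivations of the exterior algebra\<close>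

lemma linear_mv_ext: "linear (mv_ext t)"
  by (rule linearI) (simp_all add: mv_ext_def sum.distrib scaleR_sum_right algebra_simps)

lemma mv_ext_axis: "mv_ext t (axis A 1) = blade_map t (sorted_list_of_set A)"
proof -
  have "mv_ext t (axis A 1) =
      (\<Sum>B\<in>UNIV. if B = A then blade_map t (sorted_list_of_set B) else 0)"
    unfolding mv_ext_def by (intro sum.cong) (auto simp: axis_def)
  then show ?thesis by simp
qed

lemma mv_ext_one: "mv_ext t mv_one = mv_one"
  unfolding mv_one_def by (simp add: mv_ext_axis) (simp add: blade_map_def mv_one_def)

lemma sorted_list_of_set_insert_least:
  "finite A \<Longrightarrow> \<forall>j\<in>A. i < j \<Longrightarrow> sorted_list_of_set (insert i A) = i # sorted_list_of_set A"
  by (subst sorted_list_of_set.sorted_key_list_of_set_insert)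
    (auto intro!: insort_is_Cons simp: less_imp_le)

lemma mv_ext_bas_wedge_min:
  "\<forall>j\<in>A. i < j \<Longrightarrow>
    mv_ext t (mv_vec (bas i) \<and>\<^sub>m axis A 1) = mv_vec (t (bas i)) \<and>\<^sub>m mv_ext t (axis A 1)"
  unfolding mv_ext_axis
  by (simp del: sorted_list_of_set_insert_remove
      add: axis_insert_min[symmetric] mv_ext_axis sorted_list_of_set_insert_least)
    (simp add: blade_map_def)

text \<open>\<open>mv_ext\<close> is defined on sorted blades, so the claim is immediate only for
  \<open>i\<close> below all of \<open>A\<close>. When a least element \<open>a\<close> is added, a
  repeated factor kills both sides if \<open>i = a\<close>, and the case \<open>i > a\<close> is
  reduced by moving \<open>i\<close> past \<open>a\<close> on both sides.\<close>

lemma mv_ext_bas_wedge_axis: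
  "mv_ext t (mv_vec (bas i) \<and>\<^sub>m axis A 1) = mv_vec (t (bas i)) \<and>\<^sub>m mv_ext t (axis A 1)"
proof (induction A rule: finite_linorder_min_induct[OF finite])
  case 1
  show ?case by (rule mv_ext_bas_wedge_min) simp
next
  case (2 a A)
  let ?e = "mv_vec (bas i)" and ?f = "mv_vec (bas a)"
  have a: "mv_ext t (axis (insert a A) 1) = mv_vec (t (bas a)) \<and>\<^sub>m mv_ext t (axis A 1)"
    using 2(2) by (simp add: axis_insert_min mv_ext_bas_wedge_min)
  show ?case
  proof (cases i a rule: linorder_cases)
    case less
    with 2(2) show ?thesis by (intro mv_ext_bas_wedge_min) auto
  next
    case equal
    show ?thesis unfolding a unfolding equal axis_insert_min[OF 2(2)]
      by (simp add: vec_wedge_same linear_0[OF linear_mv_ext])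
  next
    case greater
    \<comment> \<open>With \<open>a\<close> in front the least-index rule applies again, because
      \<open>a\<close> lies below \<open>insert i A\<close>; if \<open>i \<in> A\<close>, both sides
      are zero.\<close>
    have "mv_ext t (?f \<and>\<^sub>m ?e \<and>\<^sub>m axis A 1) = mv_vec (t (bas a)) \<and>\<^sub>m mv_ext t (?e \<and>\<^sub>m axis A 1)"
    proof (cases "i \<in> A")
      case True
      then show ?thesis by (simp add: bas_wedge_axis wedge_linear_simps linear_0[OF linear_mv_ext])
    next
      case False
      have "mv_ext t (?f \<and>\<^sub>m axis (insert i A) 1) =
          mv_vec (t (bas a)) \<and>\<^sub>m mv_ext t (axis (insert i A) 1)"
        using greater 2(2) by (intro mv_ext_bas_wedge_min) auto
      with False show ?thesis
        by (simp add: bas_wedge_axis[of i] wedge_linear_simps linear_cmul[OF linear_mv_ext])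
    qed
    then show ?thesis
      unfolding a unfolding axis_insert_min[OF 2(2)] vec_wedge_anticommute[of "bas i"]
        vec_wedge_anticommute[of "t (bas i)"]
      by (simp add: linear_neg[OF linear_mv_ext] 2(3))
  qed
qed

lemma mv_ext_vec_wedge:
  assumes "linear t"
  shows "mv_ext t (mv_vec v \<and>\<^sub>m Y) = mv_vec (t v) \<and>\<^sub>m mv_ext t Y"
proof -
  note simps = linear_add[OF linear_mv_ext] linear_cmul[OF linear_mv_ext]
    linear_sum[OF linear_mv_ext] linear_add[OF assms] linear_cmul[OF assms]
    mv_vec_linear_simps wedge_linear_simps
  have "mv_ext t (mv_vec (bas i) \<and>\<^sub>m (\<Sum>A\<in>UNIV. Y $ A *\<^sub>R axis A 1)) =
      mv_vec (t (bas i)) \<and>\<^sub>m mv_ext t (\<Sum>A\<in>UNIV. Y $ A *\<^sub>R axis A 1)" for i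
    by (simp only: simps mv_ext_bas_wedge_axis)
  then have *: "mv_ext t (mv_vec (bas i) \<and>\<^sub>m Y) = mv_vec (t (bas i)) \<and>\<^sub>m mv_ext t Y" for i
    by (simp only: mv_expansion)
  have **: "(\<lambda>v. mv_ext t (mv_vec v \<and>\<^sub>m Y)) = (\<lambda>v. mv_vec (t v) \<and>\<^sub>m mv_ext t Y)"
    by (rule linear_eq_on_bas) (auto intro!: linearI simp: simps *)
  show ?thesis using fun_cong[OF **, of v] .
qed

lemma mv_ext_mv_ext_inverse:
  assumes "linear h" "linear t" "\<And>v. h (t v) = v"
  shows "mv_ext h (mv_ext t X) = X"
  by (rule linear_eq_on_mv[where f = "\<lambda>X. mv_ext h (mv_ext t X)" and g = "\<lambda>X. X"])
    (auto intro!: linearI simp: mv_ext_one linear_add[OF linear_mv_ext]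
      linear_cmul[OF linear_mv_ext] mv_ext_vec_wedge assms)

text \<open>The formula of \<open>lc_Lambda\<close> for an arbitrary vector map. For linear
  \<open>N\<close> it is the derivation of the exterior algebra that agrees with \<open>N\<close> on
  vectors.\<close>

definition mv_derivation :: "('n::{finite,linorder} uvec \<Rightarrow> 'n uvec) \<Rightarrow> 'n mv \<Rightarrow> 'n mv"
  where "mv_derivation N X = (\<Sum>\<mu>\<in>UNIV. mv_vec (N (bas \<mu>)) \<and>\<^sub>m (bas \<mu> \<rfloor>\<^sub>m X))"

lemma linear_mv_derivation: "linear (mv_derivation N)"
  unfolding mv_derivation_def
  by (intro linear_compose_sum ballI linear_compose[OF linear_lcontr_right linear_wedge_right,
        unfolded o_def])

lemma mv_derivation_add_op:
  "mv_derivation (\<lambda>v. M v + N v) X = mv_derivation M X + mv_derivation N X"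
  by (simp add: mv_derivation_def mv_vec_linear_simps wedge_linear_simps sum.distrib)

lemma mv_derivation_one: "mv_derivation N mv_one = 0"
  by (simp add: mv_derivation_def lcontr_one wedge_linear_simps)

text \<open>Contracting \<open>mv_vec v \<and>\<^sub>m Y\<close> gives terms with factor
  \<open>bas \<mu> \<bullet> v\<close>, which resum to \<open>N v\<close>, and terms with a minus
  sign, which is undone by moving \<open>N (bas \<mu>)\<close> past \<open>v\<close>.\<close>

lemma mv_derivation_vec_wedge:
  assumes "linear N"
  shows "mv_derivation N (mv_vec v \<and>\<^sub>m Y) = mv_vec (N v) \<and>\<^sub>m Y + mv_vec v \<and>\<^sub>m mv_derivation N Y"
proof -
  have "mv_vec (N (\<Sum>\<mu>\<in>UNIV. v $ \<mu> *\<^sub>R bas \<mu>)) \<and>\<^sub>m Y =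
      (\<Sum>\<mu>\<in>UNIV. (bas \<mu> \<bullet> v) *\<^sub>R (mv_vec (N (bas \<mu>)) \<and>\<^sub>m Y))"
    by (simp add: linear_sum[OF assms] linear_cmul[OF assms] mv_vec_linear_simps
        wedge_linear_simps inner_axis' )
  then have "mv_vec (N v) \<and>\<^sub>m Y = (\<Sum>\<mu>\<in>UNIV. (bas \<mu> \<bullet> v) *\<^sub>R (mv_vec (N (bas \<mu>)) \<and>\<^sub>m Y))"
    by (simp only: uvec_expansion)
  then show ?thesis
    by (simp add: mv_derivation_def lcontr_wedge wedge_linear_simps sum.distrib sum_subtractf
        vec_wedge_anticommute[of "N _" v] sum_negf)
qed

text \<open>Both sides obey the same Leibniz recursion: on a vector \<open>v\<close> the right-hand
  side produces \<open>t (h (N (t v)))\<close>, which is \<open>N (t v)\<close>.\<close>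

lemma mv_derivation_mv_ext:
  assumes "linear h" "linear t" "\<And>v. t (h v) = v" "linear N"
  shows "mv_derivation N (mv_ext t X) = mv_ext t (mv_derivation (\<lambda>v. h (N (t v))) X)"
proof (rule linear_eq_on_mv[where f = "\<lambda>X. mv_derivation N (mv_ext t X)"])
  have L: "linear (\<lambda>v. h (N (t v)))"
    using linear_compose[OF linear_compose[OF assms(2,4)] assms(1)] by (simp add: o_def)
  show "mv_derivation N (mv_ext t (mv_vec (bas i) \<and>\<^sub>m Y)) =
      mv_ext t (mv_derivation (\<lambda>v. h (N (t v))) (mv_vec (bas i) \<and>\<^sub>m Y))"
    if "mv_derivation N (mv_ext t Y) = mv_ext t (mv_derivation (\<lambda>v. h (N (t v))) Y)" for i Y
    using that by (simp add: mv_ext_vec_wedge mv_derivation_vec_wedge linear_add[OF linear_mv_ext]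
        L assms)
qed (simp_all add: mv_ext_one mv_derivation_one linear_0[OF linear_mv_ext]
    linear_compose[OF linear_mv_ext linear_mv_derivation, unfolded o_def]
    linear_compose[OF linear_mv_derivation linear_mv_ext, unfolded o_def])


section \<open>Commutators with bivectors\<close>

definition vec_clifford ::
    "('n::{finite,linorder} uvec \<Rightarrow> 'n uvec) \<Rightarrow> 'n uvec \<Rightarrow> 'n mv \<Rightarrow> 'n mv"
  where "vec_clifford m v Y = mv_vec v \<and>\<^sub>m Y + m v \<rfloor>\<^sub>m Y"

lemma linear_vec_clifford: "linear (vec_clifford m v)"
  by (rule linearI)
    (simp_all add: vec_clifford_def wedge_linear_simps lcontr_linear_simps algebra_simps)

lemma linear_vec_clifford_left:
  assumes "linear m"
  shows "linear (\<lambda>v. vec_clifford m v Y)"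
  by (rule linearI)
    (simp_all add: vec_clifford_def mv_vec_linear_simps wedge_linear_simps lcontr_linear_simps
      linear_add[OF assms] linear_cmul[OF assms] algebra_simps)

text \<open>The Clifford relation. Pure wedge terms and pure contraction terms cancel in pairs; the
  mixed terms leave \<open>m u \<bullet> v\<close> and \<open>m v \<bullet> u\<close>, which are
  equal by symmetry of \<open>m\<close>.\<close>

lemma vec_clifford_anticommute:
  assumes "\<And>u v. m u \<bullet> v = u \<bullet> m v"
  shows "vec_clifford m u (vec_clifford m v Y) + vec_clifford m v (vec_clifford m u Y) =
    (2 * (m u \<bullet> v)) *\<^sub>R Y"
proof -
  have "m v \<bullet> u = m u \<bullet> v" using assms by (simp add: inner_commute)
  then show ?thesis
    by (simp add: vec_clifford_def wedge_linear_simps lcontr_linear_simps lcontr_wedge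
        vec_wedge_anticommute[of v u] lcontr_anticommute[of "m v" "m u"] scaleR_2 flip:
            scaleR_scaleR)
qed

lemma linear_blade_clifford: "linear (blade_clifford m is)"
\<comment> \<open>The recursion never changes \<open>Y\<close>, so the third argument of the
  induction rule is filled with a dummy \<open>0\<close>.\<close>
proof (induction m "is" "0::'a mv" rule: blade_clifford.induct)
  case (1 m)
  show ?case by (rule linearI) simp_all
next
  case (2 m i "is")
  have *: "linear (\<lambda>Y. vec_clifford m (bas i) (blade_clifford m is Y) -
      (\<Sum>k<length is. ((-1) ^ k * (m (bas i) \<bullet> bas (is ! k))) *\<^sub>R
            blade_clifford m (take k is @ drop (Suc k) is) Y))"
    using 2 by (intro linear_compose_sub linear_compose_sum ballI linear_compose_scale_right
        linear_compose[OF _ linear_vec_clifford, unfolded o_def]) auto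
  show ?case
    by (rule back_subst[of linear, OF *]) (auto simp: vec_clifford_def)
qed

lemma linear_clifford_left: "linear (\<lambda>X. clifford m X Y)"
  by (rule linearI)
    (simp_all add: clifford_def sum.distrib scaleR_sum_right algebra_simps)

lemma linear_clifford_right: "linear (clifford m X)"
  unfolding clifford_def
  by (intro linear_compose_sum ballI linear_compose_scale_right linear_blade_clifford)

lemma clifford_axis: "clifford m (axis A 1) Y = blade_clifford m (sorted_list_of_set A) Y"
proof -
  have "clifford m (axis A 1) Y =
      (\<Sum>B\<in>UNIV. if B = A then blade_clifford m (sorted_list_of_set B) Y else 0)"
    unfolding clifford_def by (intro sum.cong) (auto simp: axis_def)
  then show ?thesis by simp
qed

lemma clifford_bas_wedge_less:
  assumes "i < j"
  shows "clifford m (mv_vec (bas i) \<and>\<^sub>m mv_vec (bas j)) Y =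
    vec_clifford m (bas i) (vec_clifford m (bas j) Y) - (m (bas i) \<bullet> bas j) *\<^sub>R Y"
proof -
  have "mv_vec (bas i) \<and>\<^sub>m mv_vec (bas j) = axis {i, j} 1"
    using assms axis_insert_min[of "{j}" i] by (simp add: mv_vec_bas)
  moreover have "sorted_list_of_set {i, j} = [i, j]"
    using assms sorted_list_of_set_insert_least[of "{j}" i] by simp
  ultimately show ?thesis by (simp add: clifford_axis vec_clifford_def)
qed

lemma vec_wedge_vec_anticommute: "mv_vec u \<and>\<^sub>m mv_vec v = - (mv_vec v \<and>\<^sub>m mv_vec u)"
  using vec_wedge_anticommute[of u v mv_one] by (simp add: wedge_one)

text \<open>By the Clifford relation, exchanging \<open>u\<close> and \<open>v\<close> in
  \<open>u v - m(u) \<bullet> v\<close> changes the sign, which reduces \<open>i > j\<close> to the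
  sorted case. For \<open>i = j\<close> the expression vanishes, since a vector squares to
  \<open>m u \<bullet> u\<close>.\<close>

lemma clifford_bas_wedge:
  assumes "\<And>u v. m u \<bullet> v = u \<bullet> m v"
  shows "clifford m (mv_vec (bas i) \<and>\<^sub>m mv_vec (bas j)) Y =
    vec_clifford m (bas i) (vec_clifford m (bas j) Y) - (m (bas i) \<bullet> bas j) *\<^sub>R Y"
proof (cases i j rule: linorder_cases)
  case less
  then show ?thesis by (rule clifford_bas_wedge_less)
next
  case equal
  have "mv_vec (bas i) \<and>\<^sub>m mv_vec (bas i) = 0"
    using vec_wedge_same[of "bas i" mv_one] by (simp add: wedge_one)
  moreover have "vec_clifford m (bas i) (vec_clifford m (bas i) Y) = (m (bas i) \<bullet> bas i) *\<^sub>R Y"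
    using vec_clifford_anticommute[of m "bas i" "bas i" Y, OF assms]
    by (simp add: vec_eq_iff)
  ultimately show ?thesis using equal by (simp add: linear_0[OF linear_clifford_left])
next
  case greater
  have sym: "m (bas j) \<bullet> bas i = m (bas i) \<bullet> bas j" using assms by (simp add: inner_commute)
  have *: "- (b - r *\<^sub>R Y) = a - r *\<^sub>R Y" if "a + b = (2 * r) *\<^sub>R Y" for a b r
  proof -
    have "a = r *\<^sub>R Y + r *\<^sub>R Y - b"
      using that by (simp only: eq_diff_eq mult_2 scaleR_left_distrib)
    then show ?thesis by simp
  qed
  have "clifford m (mv_vec (bas i) \<and>\<^sub>m mv_vec (bas j)) Y =
      - clifford m (mv_vec (bas j) \<and>\<^sub>m mv_vec (bas i)) Y"
    by (simp only: vec_wedge_vec_anticommute[of "bas i" "bas j"] linear_neg[OF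
        linear_clifford_left])
  also have "\<dots> = - (vec_clifford m (bas j) (vec_clifford m (bas i) Y) - (m (bas i) \<bullet> bas j) *\<^sub>R Y)"
    by (simp only: clifford_bas_wedge_less[OF greater] sym)
  also have "\<dots> = vec_clifford m (bas i) (vec_clifford m (bas j) Y) - (m (bas i) \<bullet> bas j) *\<^sub>R Y"
    by (rule *[OF vec_clifford_anticommute[of m, OF assms]])
  finally show ?thesis .
qed

lemma clifford_vec_wedge_vec:
  assumes "linear m" "\<And>u v. m u \<bullet> v = u \<bullet> m v"
  shows "clifford m (mv_vec u \<and>\<^sub>m mv_vec w) Y =
    vec_clifford m u (vec_clifford m w Y) - (m u \<bullet> w) *\<^sub>R Y"
proof -
  note simps = linear_add[OF assms(1)] linear_cmul[OF assms(1)] mv_vec_linear_simps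
    wedge_linear_simps linear_add[OF linear_clifford_left] linear_cmul[OF linear_clifford_left]
    linear_add[OF linear_vec_clifford] linear_cmul[OF linear_vec_clifford]
    linear_add[OF linear_vec_clifford_left[OF assms(1)]]
    linear_cmul[OF linear_vec_clifford_left[OF assms(1)]] inner_add_left inner_add_right
    algebra_simps
  have *: "(\<lambda>w. clifford m (mv_vec (bas i) \<and>\<^sub>m mv_vec w) Y) =
    (\<lambda>w. vec_clifford m (bas i) (vec_clifford m w Y) - (m (bas i) \<bullet> w) *\<^sub>R Y)" for i
    by (rule linear_eq_on_bas) (auto intro!: linearI simp: simps clifford_bas_wedge assms(2))
  have i: "clifford m (mv_vec (bas i) \<and>\<^sub>m mv_vec w) Y =
    vec_clifford m (bas i) (vec_clifford m w Y) - (m (bas i) \<bullet> w) *\<^sub>R Y" for i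
    using fun_cong[OF *, of i w] .
  have **: "(\<lambda>u. clifford m (mv_vec u \<and>\<^sub>m mv_vec w) Y) =
    (\<lambda>u. vec_clifford m u (vec_clifford m w Y) - (m u \<bullet> w) *\<^sub>R Y)"
    by (rule linear_eq_on_bas) (auto intro!: linearI simp: simps i)
  show ?thesis using fun_cong[OF **, of u] .
qed

text \<open>The derivation that extends
  \<open>v \<mapsto> (m w \<bullet> v) u - (m u \<bullet> v) w\<close>, for symmetric
  \<open>m\<close> the infinitesimal \<open>m\<close>-rotation in the plane of \<open>u\<close> and
  \<open>w\<close>.\<close>

definition plane_action ::
    "('n::{finite,linorder} uvec \<Rightarrow> 'n uvec) \<Rightarrow> 'n uvec \<Rightarrow> 'n uvec \<Rightarrow> 'n mv \<Rightarrow> 'n mv"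
  where "plane_action m u w Y = mv_vec u \<and>\<^sub>m (m w \<rfloor>\<^sub>m Y) - mv_vec w \<and>\<^sub>m (m u \<rfloor>\<^sub>m Y)"

lemma linear_plane_action: "linear (plane_action m u w)"
  by (rule linearI)
    (simp_all add: plane_action_def wedge_linear_simps lcontr_linear_simps algebra_simps)

text \<open>Being \<open>m\<close>-antisymmetric, the infinitesimal rotation is a derivation of the
  Clifford product as well; the extra terms are Clifford multiplication by the rotated
  \<open>v\<close>.\<close>

lemma plane_action_vec_clifford:
  assumes "linear m" "\<And>u v. m u \<bullet> v = u \<bullet> m v"
  shows "plane_action m u w (vec_clifford m v Y) = vec_clifford m v (plane_action m u w Y) +
    (m w \<bullet> v) *\<^sub>R vec_clifford m u Y - (m u \<bullet> v) *\<^sub>R vec_clifford m w Y"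
proof -
  have "m v \<bullet> u = m u \<bullet> v" "m v \<bullet> w = m w \<bullet> v" using assms(2) by (simp_all add: inner_commute)
  then show ?thesis
    by (simp add: plane_action_def vec_clifford_def wedge_linear_simps lcontr_linear_simps
        lcontr_wedge
        vec_wedge_anticommute[of v] lcontr_anticommute[of "m v"] scaleR_right_distrib
            scaleR_right_diff_distrib)
qed

text \<open>Moving \<open>v\<close> left past \<open>w\<close> and then past \<open>u\<close> uses
  the Clifford relation twice. The extra terms are twice those of \<open>plane_action\<close>, so
  left multiplication by the plane minus \<open>2 *\<^sub>R plane_action\<close> commutes with every
  vector. This 2 later meets the \<open>1/2\<close> of \<open>comm_prod\<close>.\<close>

lemma clifford_plane_vec_clifford:
  assumes "linear m" "\<And>u v. m u \<bullet> v = u \<bullet> m v"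
  shows "clifford m (mv_vec u \<and>\<^sub>m mv_vec w) (vec_clifford m v Y) =
    vec_clifford m v (clifford m (mv_vec u \<and>\<^sub>m mv_vec w) Y) +
    (2 * (m w \<bullet> v)) *\<^sub>R vec_clifford m u Y - (2 * (m u \<bullet> v)) *\<^sub>R vec_clifford m w Y"
proof -
  have anti: "vec_clifford m x (vec_clifford m y Z) =
      (2 * (m x \<bullet> y)) *\<^sub>R Z - vec_clifford m y (vec_clifford m x Z)" for x y Z
    unfolding vec_clifford_anticommute[of m x y Z, OF assms(2), symmetric] by simp
  note simps = linear_diff[OF linear_vec_clifford] linear_cmul[OF linear_vec_clifford]
  show ?thesis
    unfolding clifford_vec_wedge_vec[OF assms] simps anti[of w v Y]
      anti[of u v "vec_clifford m w Y"]
    by simp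
qed

text \<open>Iterating the antiderivation rule along the list gives the kind of sum that
  \<open>blade_clifford\<close> subtracts, so that sum can be read as a contraction of the tail
  blade.\<close>

lemma lcontr_blade:
  "v \<rfloor>\<^sub>m blade_map (\<lambda>x. x) is =
    (\<Sum>k<length is. ((-1) ^ k * (v \<bullet> bas (is ! k))) *\<^sub>R
      blade_map (\<lambda>x. x) (take k is @ drop (Suc k) is))"
proof (induction "is")
  case Nil
  show ?case by (simp add: blade_map_def lcontr_one)
next
  case (Cons j "is")
  have cons: "blade_map (\<lambda>x. x) (j # js) = mv_vec (bas j) \<and>\<^sub>m blade_map (\<lambda>x. x) js" for js
    by (simp add: blade_map_def)
  show ?case
    unfolding cons lcontr_wedge Cons.IH
    by (simp del: sum.lessThan_Suc add: sum.lessThan_Suc_shift cons wedge_linear_simps sum_negf)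
qed

text \<open>
  Right multiplication by \<open>u \<and> w\<close> is the only operator that commutes with left multiplication by
  every vector and sends \<open>1\<close> to \<open>u \<and> w\<close>; the operator on the right-hand side does both.
\<close>

lemma blade_clifford_plane:
  assumes "linear m" "\<And>u v. m u \<bullet> v = u \<bullet> m v"
  shows "blade_clifford m is (mv_vec u \<and>\<^sub>m mv_vec w) =
    clifford m (mv_vec u \<and>\<^sub>m mv_vec w) (blade_map (\<lambda>x. x) is) -
    2 *\<^sub>R plane_action m u w (blade_map (\<lambda>x. x) is)"
proof -
  define F where "F Y = clifford m (mv_vec u \<and>\<^sub>m mv_vec w) Y - 2 *\<^sub>R plane_action m u w Y" for Y
  have linF: "linear F"
    unfolding F_def
    by (intro linear_compose_sub linear_compose_scale_right linear_clifford_right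
        linear_plane_action)
  have comm: "F (vec_clifford m v Y) = vec_clifford m v (F Y)" for v Y
    by (simp add: F_def clifford_plane_vec_clifford[OF assms] plane_action_vec_clifford[OF assms]
        linear_diff[OF linear_vec_clifford] linear_cmul[OF linear_vec_clifford]
        scaleR_right_distrib scaleR_right_diff_distrib)
  have "blade_clifford m is (mv_vec u \<and>\<^sub>m mv_vec w) = F (blade_map (\<lambda>x. x) is)"
  \<comment> \<open>The recursion also calls lists with an inner entry removed, hence induction on
    the length.\<close>
  proof (induction "is" rule: length_induct)
    case (1 "is")
    show ?case
    proof (cases "is")
      case Nil
      show ?thesis
        unfolding Nil
        by (simp add: F_def blade_map_def clifford_vec_wedge_vec[OF assms] vec_clifford_def
            wedge_one lcontr_one lcontr_vec plane_action_def wedge_linear_simps lcontr_linear_simps)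
    next
      case (Cons i js)
      have "blade_clifford m js (mv_vec u \<and>\<^sub>m mv_vec w) = F (blade_map (\<lambda>x. x) js)"
        using 1 Cons by simp
      moreover have "blade_clifford m (take k js @ drop (Suc k) js) (mv_vec u \<and>\<^sub>m mv_vec w) =
          F (blade_map (\<lambda>x. x) (take k js @ drop (Suc k) js))" if "k < length js" for k
        using 1 Cons that by simp
      ultimately have "blade_clifford m is (mv_vec u \<and>\<^sub>m mv_vec w) =
          vec_clifford m (bas i) (F (blade_map (\<lambda>x. x) js)) - F (m (bas i) \<rfloor>\<^sub>m blade_map (\<lambda>x. x)
              js)"
        unfolding Cons by (simp add: vec_clifford_def lcontr_blade linear_sum[OF linF]
            linear_cmul[OF linF])
      also have "\<dots> = F (mv_vec (bas i) \<and>\<^sub>m blade_map (\<lambda>x. x) js)"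
        unfolding comm[symmetric] linear_diff[OF linF, symmetric] by (simp add: vec_clifford_def)
      finally show ?thesis
        unfolding Cons by (simp add: blade_map_def)
    qed
  qed
  then show ?thesis by (simp add: F_def)
qed

lemma blade_map_id: "blade_map (\<lambda>x. x) (sorted_list_of_set A) = axis A 1"
proof (induction A rule: finite_linorder_min_induct[OF finite])
  case 1
  show ?case by (simp add: blade_map_def mv_one_def)
next
  case (2 i A)
  then show ?case
    unfolding sorted_list_of_set_insert_least[OF 2(1,2)] axis_insert_min[OF 2(2)]
    by (simp add: blade_map_def)
qed

lemma clifford_plane_right:
  assumes "linear m" "\<And>u v. m u \<bullet> v = u \<bullet> m v"
  shows "clifford m Y (mv_vec u \<and>\<^sub>m mv_vec w) =
    clifford m (mv_vec u \<and>\<^sub>m mv_vec w) Y - 2 *\<^sub>R plane_action m u w Y"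
proof -
  define F where "F Y = clifford m (mv_vec u \<and>\<^sub>m mv_vec w) Y - 2 *\<^sub>R plane_action m u w Y" for Y
  have linF: "linear F"
    unfolding F_def
    by (intro linear_compose_sub linear_compose_scale_right linear_clifford_right
        linear_plane_action)
  have "clifford m Y (mv_vec u \<and>\<^sub>m mv_vec w) = (\<Sum>A\<in>UNIV. Y $ A *\<^sub>R F (axis A 1))"
    by (simp add: clifford_def[of m Y] blade_clifford_plane[OF assms] blade_map_id F_def)
  also have "\<dots> = F (\<Sum>A\<in>UNIV. Y $ A *\<^sub>R axis A 1)"
    by (simp only: linear_sum[OF linF] linear_cmul[OF linF])
  finally show ?thesis by (simp only: mv_expansion F_def)
qed

lemma comm_prod_plane:
  assumes "linear m" "\<And>u v. m u \<bullet> v = u \<bullet> m v"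
  shows "comm_prod m (mv_vec u \<and>\<^sub>m mv_vec w) Y =
    mv_vec u \<and>\<^sub>m (m w \<rfloor>\<^sub>m Y) - mv_vec w \<and>\<^sub>m (m u \<rfloor>\<^sub>m Y)"
  by (simp add: comm_prod_def clifford_plane_right[OF assms] plane_action_def)

lemma linear_comm_prod_left: "linear (\<lambda>X. comm_prod m X Y)"
  unfolding comm_prod_def
  by (intro linear_compose_sub linear_compose_scale_right linear_clifford_left
      linear_clifford_right)

lemma comm_prod_plane_sum:
  fixes c :: "'n::{finite,linorder} \<Rightarrow> 'n \<Rightarrow> real"
  assumes "linear m" "\<And>u v. m u \<bullet> v = u \<bullet> m v"
  shows "comm_prod m (\<Sum>i\<in>UNIV. \<Sum>j\<in>UNIV. c i j *\<^sub>R (mv_vec (u i) \<and>\<^sub>m mv_vec (u j))) Y =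
    (\<Sum>i\<in>UNIV. \<Sum>j\<in>UNIV. c i j *\<^sub>R
      (mv_vec (u i) \<and>\<^sub>m (m (u j) \<rfloor>\<^sub>m Y) - mv_vec (u j) \<and>\<^sub>m (m (u i) \<rfloor>\<^sub>m Y)))"
  by (simp only: linear_sum[OF linear_comm_prod_left] linear_cmul[OF linear_comm_prod_left]
      comm_prod_plane[OF assms])

section \<open>Bivectors and their commutators with vectors\<close>

lemma bas_wedge_bas:
  "mv_vec (bas i) \<and>\<^sub>m mv_vec (bas j) = (if i = j then 0 else blade_sign {i} {j} *\<^sub>R axis {i, j} 1)"
  using bas_wedge_axis[of i "{j}"] by (simp add: mv_vec_bas)

lemma bivector_plane: "bivector (mv_vec u \<and>\<^sub>m mv_vec w)"
proof -
  have "(\<Sum>j\<in>UNIV. \<Sum>i\<in>UNIV. (w $ j * u $ i) *\<^sub>R (mv_vec (bas i) \<and>\<^sub>m mv_vec (bas j))) =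
      mv_vec (\<Sum>i\<in>UNIV. u $ i *\<^sub>R bas i) \<and>\<^sub>m mv_vec (\<Sum>j\<in>UNIV. w $ j *\<^sub>R bas j)"
    by (simp only: mv_vec_linear_simps wedge_linear_simps scaleR_sum_right scaleR_scaleR)
  then have eq: "mv_vec u \<and>\<^sub>m mv_vec w =
      (\<Sum>j\<in>UNIV. \<Sum>i\<in>UNIV. (w $ j * u $ i) *\<^sub>R (mv_vec (bas i) \<and>\<^sub>m mv_vec (bas j)))"
    by (simp only: uvec_expansion)
  have "(mv_vec (bas i) \<and>\<^sub>m mv_vec (bas j)) $ A = 0" if "card A \<noteq> 2" for i j and A :: "'a set"
    using that unfolding bas_wedge_bas by (auto simp: axis_def)
  then show ?thesis
    unfolding bivector_def eq by simp
qed

lemma bivector_sum: "(\<And>i. i \<in> I \<Longrightarrow> bivector (f i)) \<Longrightarrow> bivector (\<Sum>i\<in>I. f i)"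
  by (auto simp: bivector_def)

lemma bivector_scaleR: "bivector B \<Longrightarrow> bivector (r *\<^sub>R B)"
  by (auto simp: bivector_def)

lemma bivector_diff: "bivector A \<Longrightarrow> bivector B \<Longrightarrow> bivector (A - B)"
  by (auto simp: bivector_def)

text \<open>The condition \<open>i < j\<close> counts each two-element index set once. Linear
  statements about bivectors are thereby reduced to planes.\<close>

lemma bivector_expansion:
  assumes "bivector B"
  shows "B = (\<Sum>i\<in>UNIV. \<Sum>j\<in>UNIV. (if i < j then B $ {i, j} else 0) *\<^sub>R
    (mv_vec (bas i) \<and>\<^sub>m mv_vec (bas j)))"
proof -
  have coeff: "B $ A = (\<Sum>i\<in>UNIV. \<Sum>j\<in>UNIV. if i < j \<and> A = {i, j} then B $ A else 0)" for A
  proof (cases "\<exists>a b. a < b \<and> A = {a, b}")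
    case True
    then obtain a b where ab: "a < b" "A = {a, b}" by blast
    have "i < j \<and> A = {i, j} \<longleftrightarrow> i = a \<and> j = b" for i j
      using ab by (auto simp: doubleton_eq_iff)
    then have "(\<Sum>j\<in>UNIV. if i < j \<and> A = {i, j} then B $ A else 0) =
        (if i = a then (\<Sum>j\<in>UNIV. if j = b then B $ A else 0) else 0)" for i
      by simp
    then show ?thesis by simp
  next
    case False
    then have "card A \<noteq> 2"
      by (metis card_2_iff insert_commute neqE)
    with False assms show ?thesis
      by (auto simp: bivector_def intro!: sum.neutral sym[OF sum.neutral])
  qed
  have summand: "((if i < j then B $ {i, j} else 0) *\<^sub>R (mv_vec (bas i) \<and>\<^sub>m mv_vec (bas j))) $ A =
      (if i < j \<and> A = {i, j} then B $ A else 0)" for i j A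
    using blade_sign_min[of "{j}" i] unfolding bas_wedge_bas by (auto simp: axis_def)
  show ?thesis
    unfolding vec_eq_iff sum_component summand by (intro allI coeff)
qed

text \<open>On the plane of \<open>u\<close> and \<open>w\<close> both sides are
  \<open>(m w \<bullet> v) u - (m u \<bullet> v) w\<close>; the rest is linearity in
  \<open>B\<close>.\<close>

lemma comm_prod_bivector_vec:
  assumes "linear m" "\<And>u v. m u \<bullet> v = u \<bullet> m v" "bivector B"
  shows "comm_prod m B (mv_vec v) = - (m v \<rfloor>\<^sub>m B)"
proof -
  have "m v \<bullet> u = m u \<bullet> v" for u using assms(2) by (simp add: inner_commute)
  then have *: "comm_prod m (mv_vec u \<and>\<^sub>m mv_vec w) (mv_vec v) = - (m v \<rfloor>\<^sub>m (mv_vec u \<and>\<^sub>m mv_vec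
      w))"
    for u w
    by (simp add: comm_prod_plane[OF assms(1,2)] lcontr_vec lcontr_wedge wedge_linear_simps
        wedge_one)
  show ?thesis
    by (subst (1 2) bivector_expansion[OF assms(3)])
      (simp only: linear_sum[OF linear_comm_prod_left] linear_cmul[OF linear_comm_prod_left]
        lcontr_linear_simps * sum_negf scaleR_minus_right)
qed

text \<open>Contraction with \<open>bas i\<close> for some \<open>i \<in> A\<close> reads off the
  coefficient at \<open>A\<close> up to sign. It misses only \<open>A = {}\<close>, where a bivector
  has coefficient zero.\<close>

lemma bivector_eq_0:
  assumes "bivector B" "\<And>v. v \<rfloor>\<^sub>m B = 0"
  shows "B = 0"
proof -
  have "B $ A = 0" for A
  proof (cases "A = {}")
    case True
    with assms(1) show ?thesis by (simp add: bivector_def)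
  next
    case False
    then obtain i where "i \<in> A" by blast
    then have "blade_sign {i} (A - {i}) * (bas i \<rfloor>\<^sub>m B) $ (A - {i}) = B $ A"
      by (simp add: bas_lcontr_nth insert_absorb blade_sign_cancel)
    then show ?thesis using assms(2)[of "bas i"] by simp
  qed
  then show ?thesis by (simp add: vec_eq_iff)
qed

text \<open>Since \<open>m\<close> is onto, commutators with vectors supply all contractions of
  \<open>A - B\<close>. The uniqueness of the connection rests on this.\<close>

lemma bivector_eq_if_comm_prod_eq:
  assumes "linear m" "\<And>u v. m u \<bullet> v = u \<bullet> m v" "surj m" "bivector A" "bivector B"
    "\<And>v. comm_prod m A (mv_vec v) = comm_prod m B (mv_vec v)"
  shows "A = B"
proof -
  have "v \<rfloor>\<^sub>m (A - B) = 0" for v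
  proof -
    obtain w where "v = m w" using assms(3) by (metis surjD)
    then show ?thesis
      using assms(6)[of w] by (simp add: comm_prod_bivector_vec[OF assms(1,2)] assms(4,5)
          lcontr_linear_simps)
  qed
  then show ?thesis using bivector_eq_0[OF bivector_diff[OF assms(4,5)]] by simp
qed


section \<open>Functions of class \<open>C\<^sup>k\<close>\<close>

lemma Ck_on_SucI:
  assumes "\<And>x. x \<in> S \<Longrightarrow> (f has_derivative f' x) (at x)"
    and "\<And>v. Ck_on S k (\<lambda>x. frechet_derivative f (at x) v)"
  shows "Ck_on S (Suc k) f"
  using assms by (auto simp: differentiable_def)

lemma Ck_on_Suc_has_derivative:
  "Ck_on S (Suc k) f \<Longrightarrow> x \<in> S \<Longrightarrow> (f has_derivative frechet_derivative f (at x)) (at x)"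
  by (simp add: frechet_derivative_works)

text \<open>On an open set, agreement on \<open>S\<close> is agreement near each point of
  \<open>S\<close>, so all derivatives agree there too.\<close>

lemma Ck_on_cong:
  assumes "open S" "\<And>x. x \<in> S \<Longrightarrow> f x = g x"
  shows "Ck_on S k f \<longleftrightarrow> Ck_on S k g"
  using assms(2)
proof (induction k arbitrary: f g)
  case 0
  then show ?case by (simp cong: continuous_on_cong)
next
  case (Suc k)
  have d: "(f has_derivative f') (at x) \<longleftrightarrow> (g has_derivative f') (at x)" if "x \<in> S" for x f'
    using that Suc.prems assms(1)
    by (auto intro: has_derivative_transform_within_open[where s = S])
  then have "f differentiable at x \<longleftrightarrow> g differentiable at x" if "x \<in> S" for x
    using that by (simp add: differentiable_def)
  moreover have "frechet_derivative f (at x) = frechet_derivative g (at x)" if "x \<in> S" for x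
    using d[OF that] by (simp add: frechet_derivative_def)
  then have "Ck_on S k (\<lambda>x. frechet_derivative f (at x) v) \<longleftrightarrow>
      Ck_on S k (\<lambda>x. frechet_derivative g (at x) v)" for v
    by (intro Suc.IH) simp
  ultimately show ?case by auto
qed

text \<open>\<open>Ck_on\<close> speaks of the chosen \<open>frechet_derivative\<close>; here any
  explicit derivative formula valid on \<open>S\<close> may take its place, as the closure rules
  below require.\<close>

lemma Ck_on_SucI':
  assumes "open S" "\<And>x. x \<in> S \<Longrightarrow> (f has_derivative f' x) (at x)"
    and "\<And>v. Ck_on S k (\<lambda>x. f' x v)"
  shows "Ck_on S (Suc k) f"
proof (rule Ck_on_SucI[OF assms(2)])
  show "Ck_on S k (\<lambda>x. frechet_derivative f (at x) v)" for v
    using assms(3)[of v]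
    by (rule Ck_on_cong[OF assms(1), THEN iffD1, rotated])
      (simp add: frechet_derivative_at[OF assms(2), symmetric])
qed

lemma Ck_on_SucD: "Ck_on S (Suc k) f \<Longrightarrow> Ck_on S k f"
proof (induction k arbitrary: f)
  case 0
  then show ?case
    by (auto intro!: continuous_at_imp_continuous_on differentiable_imp_continuous_within)
next
  case (Suc k)
  then show ?case by simp
qed

lemma Ck_on_const: "Ck_on S k (\<lambda>x. c)"
  by (induction k arbitrary: c) simp_all

lemma Ck_on_bounded_linear:
  assumes "open S" "bounded_linear L"
  shows "Ck_on S k f \<Longrightarrow> Ck_on S k (\<lambda>x. L (f x))"
proof (induction k arbitrary: f)
  case 0
  then show ?case by (simp add: bounded_linear.continuous_on[OF assms(2)])
next
  case (Suc k)
  show ?case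
  proof (rule Ck_on_SucI'[OF assms(1)])
    show "((\<lambda>x. L (f x)) has_derivative (\<lambda>v. L (frechet_derivative f (at x) v))) (at x)"
      if "x \<in> S" for x
      using Ck_on_Suc_has_derivative[OF Suc.prems that] bounded_linear.has_derivative[OF assms(2)]
          by blast
    show "Ck_on S k (\<lambda>x. L (frechet_derivative f (at x) v))" for v
      using Suc by simp
  qed
qed

lemma Ck_on_add:
  assumes "open S"
  shows "Ck_on S k f \<Longrightarrow> Ck_on S k g \<Longrightarrow> Ck_on S k (\<lambda>x. f x + g x)"
proof (induction k arbitrary: f g)
  case 0
  then show ?case by (simp add: continuous_on_add)
next
  case (Suc k)
  show ?case
  proof (rule Ck_on_SucI'[OF assms(1)])
    show "((\<lambda>x. f x + g x) has_derivative
        (\<lambda>v. frechet_derivative f (at x) v + frechet_derivative g (at x) v)) (at x)"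
      if "x \<in> S" for x
      using Ck_on_Suc_has_derivative[OF Suc.prems(1) that] Ck_on_Suc_has_derivative[OF
          Suc.prems(2) that]
      by (rule has_derivative_add)
    show "Ck_on S k (\<lambda>x. frechet_derivative f (at x) v + frechet_derivative g (at x) v)" for v
      using Suc by simp
  qed
qed

lemma Ck_on_bounded_bilinear:
  assumes "open S" "bounded_bilinear B"
  shows "Ck_on S k f \<Longrightarrow> Ck_on S k g \<Longrightarrow> Ck_on S k (\<lambda>x. B (f x) (g x))"
proof (induction k arbitrary: f g)
  case 0
  then show ?case by (simp add: bounded_bilinear.continuous_on[OF assms(2)])
next
  case (Suc k)
  show ?case
  proof (rule Ck_on_SucI'[OF assms(1)])
    show "((\<lambda>x. B (f x) (g x)) has_derivative
        (\<lambda>v. B (f x) (frechet_derivative g (at x) v) + B (frechet_derivative f (at x) v) (g x)))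
            (at x)"
      if "x \<in> S" for x
      using Ck_on_Suc_has_derivative[OF Suc.prems(1) that] Ck_on_Suc_has_derivative[OF
          Suc.prems(2) that]
      by (rule bounded_bilinear.FDERIV[OF assms(2)])
    show "Ck_on S k (\<lambda>x. B (f x) (frechet_derivative g (at x) v) +
        B (frechet_derivative f (at x) v) (g x))"
      for v
      using Suc.prems Ck_on_SucD[OF Suc.prems(1)] Ck_on_SucD[OF Suc.prems(2)]
      by (intro Ck_on_add[OF assms(1)] Suc.IH) auto
  qed
qed

lemma Ck_on_inverse:
  fixes f :: "'n::finite uvec \<Rightarrow> real"
  assumes "open S" "\<And>x. x \<in> S \<Longrightarrow> f x \<noteq> 0"
  shows "Ck_on S k f \<Longrightarrow> Ck_on S k (\<lambda>x. inverse (f x))"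
proof (induction k)
  case 0
  then show ?case using assms(2) by (auto intro!: continuous_on_inverse)
next
  case (Suc k)
  show ?case
  proof (rule Ck_on_SucI'[OF assms(1)])
    show "((\<lambda>x. inverse (f x)) has_derivative
        (\<lambda>v. - (inverse (f x) * frechet_derivative f (at x) v * inverse (f x)))) (at x)"
      if "x \<in> S" for x
      using assms(2)[OF that] Ck_on_Suc_has_derivative[OF Suc.prems that]
      by (rule Deriv.has_derivative_inverse)
    show "Ck_on S k (\<lambda>x. - (inverse (f x) * frechet_derivative f (at x) v * inverse (f x)))" for v
      using Suc Ck_on_SucD[OF Suc.prems]
      by (intro Ck_on_bounded_linear[OF assms(1) bounded_linear_minus[OF bounded_linear_ident]]
          Ck_on_bounded_bilinear[OF assms(1) bounded_bilinear_mult]) auto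
  qed
qed


section \<open>Fields on a chart region\<close>

locale chart_region =
  fixes \<kappa> :: "('m::topological_space, 'n::{finite,linorder}) chart" and U :: "'m set"
  assumes chart: "is_chart \<kappa>" and U: "open U" "U \<subseteq> fst \<kappa>"
begin

lemma open_image: "open (snd \<kappa> ` U)"
proof -
  have "homeomorphism (fst \<kappa>) (snd \<kappa> ` fst \<kappa>) (snd \<kappa>) (chart_inv \<kappa>)"
    and o: "open (snd \<kappa> ` fst \<kappa>)" using chart by (simp_all add: is_chart_def)
  moreover have "openin (top_of_set (fst \<kappa>)) U"
    using U openin_open_eq chart by (auto simp: is_chart_def openin_open_eq)
  ultimately have "openin (top_of_set (snd \<kappa> ` fst \<kappa>)) (snd \<kappa> ` U)"
    by (intro homeomorphism_imp_open_map)
  then show ?thesis using o by (simp add: openin_open_eq)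
qed

lemma chart_inv_chart: "p \<in> U \<Longrightarrow> chart_inv \<kappa> (snd \<kappa> p) = p"
  using chart U by (auto simp: is_chart_def homeomorphism_def)

lemma smooth_field_iff_Ck_on:
  "smooth_field \<kappa> U X \<longleftrightarrow> (\<forall>k. Ck_on (snd \<kappa> ` U) k (\<lambda>y. X (chart_inv \<kappa> y)))"
  by (simp add: smooth_field_def smooth_on_def o_def)

lemma smooth_field_cong:
  assumes "\<And>p. p \<in> U \<Longrightarrow> X p = Y p"
  shows "smooth_field \<kappa> U X \<longleftrightarrow> smooth_field \<kappa> U Y"
  unfolding smooth_field_iff_Ck_on
  by (intro all_cong1 Ck_on_cong open_image) (auto simp: chart_inv_chart assms)

lemma smooth_field_const: "smooth_field \<kappa> U (\<lambda>p. c)"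
  by (simp add: smooth_field_iff_Ck_on Ck_on_const)

lemma smooth_field_bounded_linear:
  "bounded_linear L \<Longrightarrow> smooth_field \<kappa> U X \<Longrightarrow> smooth_field \<kappa> U (\<lambda>p. L (X p))"
  by (auto simp: smooth_field_iff_Ck_on intro: Ck_on_bounded_linear[OF open_image])

lemma smooth_field_bounded_bilinear:
  "bounded_bilinear B \<Longrightarrow> smooth_field \<kappa> U X \<Longrightarrow> smooth_field \<kappa> U Y \<Longrightarrow>
    smooth_field \<kappa> U (\<lambda>p. B (X p) (Y p))"
  by (auto simp: smooth_field_iff_Ck_on intro: Ck_on_bounded_bilinear[OF open_image])

lemma smooth_field_add:
  "smooth_field \<kappa> U X \<Longrightarrow> smooth_field \<kappa> U Y \<Longrightarrow> smooth_field \<kappa> U (\<lambda>p. X p + Y p)"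
  by (simp add: smooth_field_iff_Ck_on Ck_on_add open_image)

lemma smooth_field_diff:
  assumes "smooth_field \<kappa> U X" "smooth_field \<kappa> U Y"
  shows "smooth_field \<kappa> U (\<lambda>p. X p - Y p)"
  using smooth_field_add[OF assms(1) smooth_field_bounded_linear[OF
        bounded_linear_minus[OF bounded_linear_ident] assms(2)]] by simp

lemma smooth_field_sum:
  "(\<And>i. i \<in> I \<Longrightarrow> smooth_field \<kappa> U (X i)) \<Longrightarrow> smooth_field \<kappa> U (\<lambda>p. \<Sum>i\<in>I. X i p)"
  by (induction I rule: infinite_finite_induct)
    (simp_all add: smooth_field_const smooth_field_add)

lemmas smooth_field_scaleR = smooth_field_bounded_bilinear[OF bounded_bilinear_scaleR]
lemmas smooth_field_mult = smooth_field_bounded_bilinear[OF bounded_bilinear_mult]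
lemmas smooth_field_inner = smooth_field_bounded_bilinear[OF bounded_bilinear_inner]
lemmas smooth_field_nth = smooth_field_bounded_linear[OF bounded_linear_vec_nth]

lemma smooth_field_prod:
  fixes X :: "'i \<Rightarrow> 'm \<Rightarrow> real"
  shows "(\<And>i. i \<in> I \<Longrightarrow> smooth_field \<kappa> U (X i)) \<Longrightarrow> smooth_field \<kappa> U (\<lambda>p. \<Prod>i\<in>I. X i p)"
  by (induction I rule: infinite_finite_induct)
    (simp_all add: smooth_field_const smooth_field_mult)

lemma smooth_field_inverse:
  fixes X :: "'m \<Rightarrow> real"
  assumes "\<And>p. p \<in> U \<Longrightarrow> X p \<noteq> 0" "smooth_field \<kappa> U X"
  shows "smooth_field \<kappa> U (\<lambda>p. inverse (X p))"
  using assms unfolding smooth_field_iff_Ck_on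
  by (intro allI Ck_on_inverse[OF open_image]) (auto simp: chart_inv_chart)

lemma smooth_field_vec:
  fixes X :: "'m \<Rightarrow> 'k::finite uvec"
  assumes "\<And>i. smooth_field \<kappa> U (\<lambda>p. X p $ i)"
  shows "smooth_field \<kappa> U X"
proof -
  have "smooth_field \<kappa> U (\<lambda>p. \<Sum>i\<in>UNIV. X p $ i *\<^sub>R bas i)"
    by (intro smooth_field_sum smooth_field_scaleR smooth_field_const assms)
  then show ?thesis by (simp only: uvec_expansion)
qed

lemma smooth_field_det:
  assumes "\<And>i j. smooth_field \<kappa> U (\<lambda>p. M p $ i $ j :: real)"
  shows "smooth_field \<kappa> U (\<lambda>p. det (M p :: real ^ 'k::finite ^ 'k))"
  unfolding det_def
  by (intro smooth_field_sum smooth_field_mult smooth_field_prod smooth_field_const assms)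

text \<open>The bridge from sums of partial derivatives to Frechet derivatives, through which the
  sum and product rules for \<open>dir_deriv\<close> are inherited from
  \<open>has_derivative\<close>.\<close>

lemma has_derivative_dir_deriv_eq:
  assumes "p \<in> U" "((\<lambda>y. X (chart_inv \<kappa> y)) has_derivative D) (at (snd \<kappa> p))"
  shows "dir_deriv \<kappa> a X p = D a"
proof -
  have lin: "linear D" by (rule has_derivative_linear[OF assms(2)])
  have "coord_deriv \<kappa> \<mu> X p = D (bas \<mu>)" for \<mu>
  proof -
    have "((\<lambda>s. snd \<kappa> p + s *\<^sub>R bas \<mu>) has_derivative (\<lambda>s. s *\<^sub>R bas \<mu>)) (at 0)"
      by (auto intro!: derivative_eq_intros)
    then have "((\<lambda>s. X (chart_inv \<kappa> (snd \<kappa> p + s *\<^sub>R bas \<mu>))) has_derivative (\<lambda>s. D (s *\<^sub>R bas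
        \<mu>))) (at 0)"
      by (rule has_derivative_compose) (use assms(2) in simp)
    then show ?thesis
      unfolding coord_deriv_def
      by (intro vector_derivative_at) (simp add: has_vector_derivative_def linear_cmul[OF lin])
  qed
  then have "dir_deriv \<kappa> a X p = (\<Sum>\<mu>\<in>UNIV. (a $ \<mu>) *\<^sub>R D (bas \<mu>))"
    by (simp add: dir_deriv_def inner_axis)
  also have "\<dots> = D (\<Sum>\<mu>\<in>UNIV. (a $ \<mu>) *\<^sub>R bas \<mu>)"
    by (simp only: linear_sum[OF lin] linear_cmul[OF lin])
  finally show ?thesis by (simp only: uvec_expansion)
qed

lemma smooth_field_has_derivative:
  assumes "smooth_field \<kappa> U X" "p \<in> U"
  shows "((\<lambda>y. X (chart_inv \<kappa> y)) has_derivative (\<lambda>a. dir_deriv \<kappa> a X p)) (at (snd \<kappa> p))"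
proof -
  have "Ck_on (snd \<kappa> ` U) (Suc 0) (\<lambda>y. X (chart_inv \<kappa> y))"
    using assms(1) unfolding smooth_field_iff_Ck_on by blast
  from Ck_on_Suc_has_derivative[OF this] assms(2)
  have d: "((\<lambda>y. X (chart_inv \<kappa> y)) has_derivative
      frechet_derivative (\<lambda>y. X (chart_inv \<kappa> y)) (at (snd \<kappa> p))) (at (snd \<kappa> p))" by blast
  have "(\<lambda>a. dir_deriv \<kappa> a X p) = frechet_derivative (\<lambda>y. X (chart_inv \<kappa> y)) (at (snd \<kappa> p))"
    using has_derivative_dir_deriv_eq[OF assms(2) d] by blast
  then show ?thesis using d by simp
qed

lemma linear_dir_deriv: "linear (\<lambda>a. dir_deriv \<kappa> a X p)"
  by (rule linearI)
    (simp_all add: dir_deriv_def inner_add_left sum.distrib scaleR_sum_right algebra_simps)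

lemma smooth_field_coord_deriv:
  assumes "smooth_field \<kappa> U X"
  shows "smooth_field \<kappa> U (coord_deriv \<kappa> \<mu> X)"
  unfolding smooth_field_iff_Ck_on
proof
  fix k
  have "Ck_on (snd \<kappa> ` U) (Suc k) (\<lambda>y. X (chart_inv \<kappa> y))"
    using assms unfolding smooth_field_iff_Ck_on by blast
  then have "Ck_on (snd \<kappa> ` U) k (\<lambda>y. frechet_derivative (\<lambda>y. X (chart_inv \<kappa> y)) (at y) (bas \<mu>))"
    by simp
  moreover have "frechet_derivative (\<lambda>y. X (chart_inv \<kappa> y)) (at y) (bas \<mu>) =
      coord_deriv \<kappa> \<mu> X (chart_inv \<kappa> y)" if y: "y \<in> snd \<kappa> ` U" for y
  proof -
    obtain p where p: "p \<in> U" "y = snd \<kappa> p" using y by blast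
    have "dir_deriv \<kappa> (bas \<mu>) X p = (\<Sum>\<nu>\<in>UNIV. if \<nu> = \<mu> then coord_deriv \<kappa> \<nu> X p else 0)"
      unfolding dir_deriv_def by (intro sum.cong) (auto simp: inner_axis_axis)
    then have "dir_deriv \<kappa> (bas \<mu>) X p = coord_deriv \<kappa> \<mu> X p" by simp
    then show ?thesis
      using frechet_derivative_at[OF smooth_field_has_derivative[OF assms p(1)]] p
      by (metis chart_inv_chart)
  qed
  ultimately show "Ck_on (snd \<kappa> ` U) k (\<lambda>y. coord_deriv \<kappa> \<mu> X (chart_inv \<kappa> y))"
    by (rule Ck_on_cong[OF open_image, THEN iffD1, rotated])
qed

lemma smooth_field_dir_deriv:
  assumes "smooth_field \<kappa> U X" "smooth_field \<kappa> U a"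
  shows "smooth_field \<kappa> U (\<lambda>p. dir_deriv \<kappa> (a p) X p)"
  unfolding dir_deriv_def
  by (intro smooth_field_sum smooth_field_scaleR smooth_field_inner smooth_field_const
      smooth_field_coord_deriv assms)

lemma dir_deriv_const: "p \<in> U \<Longrightarrow> dir_deriv \<kappa> a (\<lambda>q. c) p = 0"
  by (rule has_derivative_dir_deriv_eq) auto

text \<open>Values of a field off \<open>U\<close> carry no meaning; since the image of
  \<open>U\<close> is open, the derivative at \<open>p\<close> does not see them.\<close>

lemma dir_deriv_cong:
  assumes "\<And>q. q \<in> U \<Longrightarrow> X q = Y q" "smooth_field \<kappa> U X" "p \<in> U"
  shows "dir_deriv \<kappa> a Y p = dir_deriv \<kappa> a X p"
  by (rule has_derivative_dir_deriv_eq[OF assms(3)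
        has_derivative_transform_within_open[OF smooth_field_has_derivative[OF assms(2,3)]
            open_image]])
    (use assms in \<open>auto simp: chart_inv_chart\<close>)

lemma dir_deriv_bounded_bilinear:
  assumes "bounded_bilinear B" "smooth_field \<kappa> U X" "smooth_field \<kappa> U Y" "p \<in> U"
  shows "dir_deriv \<kappa> a (\<lambda>q. B (X q) (Y q)) p =
    B (X p) (dir_deriv \<kappa> a Y p) + B (dir_deriv \<kappa> a X p) (Y p)"
  using has_derivative_dir_deriv_eq[OF assms(4) bounded_bilinear.FDERIV[OF assms(1)
        smooth_field_has_derivative[OF assms(2,4)] smooth_field_has_derivative[OF assms(3,4)]]]
  by (simp add: chart_inv_chart assms(4))

lemma dir_deriv_bounded_linear:
  assumes "bounded_linear L" "smooth_field \<kappa> U X" "p \<in> U"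
  shows "dir_deriv \<kappa> a (\<lambda>q. L (X q)) p = L (dir_deriv \<kappa> a X p)"
  by (rule has_derivative_dir_deriv_eq[OF assms(3) bounded_linear.has_derivative[OF assms(1)
        smooth_field_has_derivative[OF assms(2,3)]]])

lemma dir_deriv_sum:
  assumes "\<And>i. i \<in> I \<Longrightarrow> smooth_field \<kappa> U (X i)" "p \<in> U"
  shows "dir_deriv \<kappa> a (\<lambda>q. \<Sum>i\<in>I. X i q) p = (\<Sum>i\<in>I. dir_deriv \<kappa> a (X i) p)"
  by (rule has_derivative_dir_deriv_eq[OF assms(2) has_derivative_sum])
    (rule smooth_field_has_derivative[OF assms])

section \<open>Derivatives of extensor fields applied to vector fields\<close>

lemma extensor_field11_apply_eq:
  assumes "extensor_field11 \<kappa> U t" "q \<in> U"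
  shows "t q v = (\<Sum>i\<in>UNIV. v $ i *\<^sub>R t q (bas i))"
proof -
  have lin: "linear (t q)" using assms by (simp add: extensor_field11_def)
  have "t q (\<Sum>i\<in>UNIV. v $ i *\<^sub>R bas i) = (\<Sum>i\<in>UNIV. v $ i *\<^sub>R t q (bas i))"
    by (simp only: linear_sum[OF lin] linear_cmul[OF lin])
  then show ?thesis by (simp only: uvec_expansion)
qed

lemma smooth_field_apply:
  assumes "extensor_field11 \<kappa> U t" "smooth_field \<kappa> U v"
  shows "smooth_field \<kappa> U (\<lambda>q. t q (v q))"
proof -
  have "smooth_field \<kappa> U (\<lambda>q. \<Sum>i\<in>UNIV. v q $ i *\<^sub>R t q (bas i))"
    using assms(1)
    by (intro smooth_field_sum smooth_field_scaleR smooth_field_nth assms(2))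
      (simp add: extensor_field11_def)
  then show ?thesis
    by (rule smooth_field_cong[THEN iffD1, rotated]) (simp add: extensor_field11_apply_eq[OF
        assms(1), symmetric])
qed

lemma dir_deriv_apply_expansion:
  assumes "extensor_field11 \<kappa> U t" "smooth_field \<kappa> U v" "p \<in> U"
  shows "dir_deriv \<kappa> a (\<lambda>q. t q (v q)) p =
    t p (dir_deriv \<kappa> a v p) + (\<Sum>i\<in>UNIV. v p $ i *\<^sub>R dir_deriv \<kappa> a (\<lambda>q. t q (bas i)) p)"
proof -
  have t: "smooth_field \<kappa> U (\<lambda>q. t q (bas i))" for i
    using assms(1) by (simp add: extensor_field11_def)
  note v = smooth_field_nth[OF assms(2)]
  have s: "smooth_field \<kappa> U (\<lambda>q. \<Sum>i\<in>UNIV. v q $ i *\<^sub>R t q (bas i))"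
    by (intro smooth_field_sum smooth_field_scaleR v t)
  have "dir_deriv \<kappa> a (\<lambda>q. t q (v q)) p =
      dir_deriv \<kappa> a (\<lambda>q. \<Sum>i\<in>UNIV. v q $ i *\<^sub>R t q (bas i)) p"
    by (rule dir_deriv_cong[OF _ s assms(3)]) (simp add: extensor_field11_apply_eq[OF assms(1),
        symmetric])
  also have "\<dots> = (\<Sum>i\<in>UNIV. dir_deriv \<kappa> a (\<lambda>q. v q $ i *\<^sub>R t q (bas i)) p)"
    by (intro dir_deriv_sum smooth_field_scaleR v t assms(3))
  also have "\<dots> = (\<Sum>i\<in>UNIV. v p $ i *\<^sub>R dir_deriv \<kappa> a (\<lambda>q. t q (bas i)) p +
      dir_deriv \<kappa> a v p $ i *\<^sub>R t p (bas i))"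
    by (simp only: dir_deriv_bounded_bilinear[OF bounded_bilinear_scaleR v t assms(3)]
        dir_deriv_bounded_linear[OF bounded_linear_vec_nth assms(2,3)])
  also have "\<dots> = t p (dir_deriv \<kappa> a v p) + (\<Sum>i\<in>UNIV. v p $ i *\<^sub>R dir_deriv \<kappa> a (\<lambda>q. t q (bas i)) p)"
    by (simp add: sum.distrib extensor_field11_apply_eq[OF assms(1,3), of "dir_deriv \<kappa> a v p"])
  finally show ?thesis .
qed

text \<open>The sum in \<open>dir_deriv_apply_expansion\<close> is the same expansion for the
  constant field with value \<open>v p\<close>, that is, the derivative of \<open>t\<close> at a
  frozen argument.\<close>

lemma dir_deriv_apply:
  assumes "extensor_field11 \<kappa> U t" "smooth_field \<kappa> U v" "p \<in> U"
  shows "dir_deriv \<kappa> a (\<lambda>q. t q (v q)) p =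
    t p (dir_deriv \<kappa> a v p) + dir_deriv \<kappa> a (\<lambda>q. t q (v p)) p"
proof -
  have "t p 0 = 0" using assms by (simp add: extensor_field11_def linear_0)
  then show ?thesis
    using dir_deriv_apply_expansion[OF assms(1) smooth_field_const assms(3), of a "v p"]
    by (simp add: dir_deriv_apply_expansion[OF assms] dir_deriv_const assms(3))
qed

lemma linear_dir_deriv_apply:
  assumes "extensor_field11 \<kappa> U t" "p \<in> U"
  shows "linear (\<lambda>v. dir_deriv \<kappa> a (\<lambda>q. t q v) p)"
proof -
  have "t p 0 = 0" using assms by (simp add: extensor_field11_def linear_0)
  define d where "d i = dir_deriv \<kappa> a (\<lambda>q. t q (bas i)) p" for i
  have "dir_deriv \<kappa> a (\<lambda>q. t q v) p = (\<Sum>i\<in>UNIV. v $ i *\<^sub>R d i)" for v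
    using dir_deriv_apply_expansion[OF assms(1) smooth_field_const assms(2), of a v] \<open>t p 0 = 0\<close>
    by (simp only: dir_deriv_const[OF assms(2)] d_def add_0)
  then show ?thesis
    by (auto intro!: linearI simp: sum.distrib scaleR_sum_right algebra_simps)
qed

lemma dir_deriv_ext_eq:
  "extensor_field11 \<kappa> U t \<Longrightarrow> p \<in> U \<Longrightarrow> dir_deriv_ext \<kappa> a t b p = dir_deriv \<kappa> a (\<lambda>q. t q b) p"
  by (simp add: dir_deriv_ext_def dir_deriv_const extensor_field11_def linear_0)

end

section \<open>Inverse fields and the derivative of an exterior extension\<close>

lemma inv_eq_cramer:
  fixes t :: "'n::finite uvec \<Rightarrow> 'n uvec"
  assumes "linear t" "det (matrix t) \<noteq> 0"
  shows "inv t b = (\<chi> k. det (\<chi> i j. if j = k then b $ i else t (bas j) $ i) / det (matrix t))"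
proof -
  have "inj t" using det_nz_iff_inj[OF assms(1)] assms(2) by simp
  then have "surj t" by (rule linear_inj_imp_surj[OF assms(1)])
  then have "t (inv t b) = b" by (rule surj_f_inv_f)
  moreover have "matrix t *v inv t b = t (inv t b)"
    using matrix_vector_mul(2)[OF assms(1)] by metis
  ultimately have "matrix t *v inv t b = b" by simp
  moreover have entry: "matrix t $ i $ j = t (bas j) $ i" for i j by (simp add: matrix_def)
  ultimately show ?thesis unfolding cramer[OF assms(2)] entry by simp
qed

text \<open>Renaming the indices turns the second half of the sum into a copy of the first. This
  doubling turns the \<open>1/4\<close> of \<open>lc_omega\<close> into \<open>1/2\<close> and
  cancels the \<open>1/2\<close> of the gauge formula.\<close>

lemma sum_antisymmetric:
  fixes F :: "'i \<Rightarrow> 'i \<Rightarrow> 'b::real_vector"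
  assumes "\<And>i j. c i j = - c j i"
  shows "(\<Sum>i\<in>I. \<Sum>j\<in>I. c i j *\<^sub>R (F i j - F j i)) = 2 *\<^sub>R (\<Sum>i\<in>I. \<Sum>j\<in>I. c i j *\<^sub>R F i j)"
proof -
  have "(\<Sum>i\<in>I. \<Sum>j\<in>I. c i j *\<^sub>R F j i) = (\<Sum>j\<in>I. \<Sum>i\<in>I. - (c j i *\<^sub>R F j i))"
    by (subst sum.swap) (simp add: assms[of _ "_ :: 'i", THEN sym] flip: scaleR_minus_left)
  then show ?thesis
    by (simp add: scaleR_right_diff_distrib sum_subtractf sum_negf scaleR_2)
qed

text \<open>Valid for unsorted lists and repeated indices as well, which suits the product-rule
  induction along a list.\<close>

lemma blade_map_eq_mv_ext:
  assumes "linear t"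
  shows "blade_map t is = mv_ext t (blade_map (\<lambda>x. x) is)"
proof (induction "is")
  case Nil
  show ?case by (simp add: blade_map_def mv_ext_one)
next
  case (Cons i "is")
  have cons: "blade_map t (i # is) = mv_vec (t (bas i)) \<and>\<^sub>m blade_map t is" for t :: "'a uvec \<Rightarrow> 'a
      uvec"
    by (simp add: blade_map_def)
  show ?case by (simp add: cons mv_ext_vec_wedge[OF assms] Cons)
qed

lemma bounded_linear_mv_vec: "bounded_linear mv_vec"
  using linear_mv_vec by (simp add: linear_conv_bounded_linear)

lemma bounded_bilinear_wedge: "bounded_bilinear (\<and>\<^sub>m)"
  using bilinear_wedge by (simp add: bilinear_conv_bounded_bilinear)

context chart_region
begin

text \<open>Smoothness comes from Cramer's rule: the components of the inverse are quotients of
  determinants built from the entries of \<open>t\<close>.\<close>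

lemma extensor_field11_inv:
  assumes "extensor_field11 \<kappa> U t" "\<And>p. p \<in> U \<Longrightarrow> det (matrix (t p)) \<noteq> 0"
  shows "extensor_field11 \<kappa> U (\<lambda>p. inv (t p))"
  unfolding extensor_field11_def
proof (intro conjI ballI allI)
  fix p assume "p \<in> U"
  then have "linear (t p)" "inj (t p)"
    using assms det_nz_iff_inj by (auto simp: extensor_field11_def)
  then show "linear (inv (t p))" by (rule inj_linear_imp_inv_linear)
next
  fix b
  have t: "smooth_field \<kappa> U (\<lambda>p. t p v)" for v using assms(1) by (simp add: extensor_field11_def)
  have m: "smooth_field \<kappa> U (\<lambda>p. inverse (det (matrix (t p))))"
    by (intro smooth_field_inverse assms(2) smooth_field_det) (simp_all add: matrix_def
        smooth_field_nth[OF t])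
  have "smooth_field \<kappa> U (\<lambda>p. \<chi> k. det (\<chi> i j. if j = k then b $ i else t p (bas j) $ i) *
      inverse (det (matrix (t p))))"
  proof (rule smooth_field_vec)
    fix k
    have "smooth_field \<kappa> U (\<lambda>p. det (\<chi> i j. if j = k then b $ i else t p (bas j) $ i) *
        inverse (det (matrix (t p))))"
    proof (intro smooth_field_mult m smooth_field_det)
      fix i j
      show "smooth_field \<kappa> U (\<lambda>p. (\<chi> i j. if j = k then b $ i else t p (bas j) $ i) $ i $ j)"
        by (cases "j = k") (simp_all add: smooth_field_const smooth_field_nth[OF t])
    qed
    then show "smooth_field \<kappa> U (\<lambda>p. (\<chi> k. det (\<chi> i j. if j = k then b $ i else t p (bas j) $ i) *
      inverse (det (matrix (t p)))) $ k)" by simp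
  qed
  then show "smooth_field \<kappa> U (\<lambda>p. inv (t p) b)"
    by (rule smooth_field_cong[THEN iffD1, rotated])
      (use assms in \<open>simp add: inv_eq_cramer extensor_field11_def divide_inverse\<close>)
qed

text \<open>The product rule differentiates one factor \<open>t q (bas i)\<close> at a time. As
  \<open>k\<close> is a right inverse of \<open>t p\<close>, the derivative of that factor is
  \<open>t p (N (bas i))\<close>, so the result is the \<open>t p\<close>-image of a
  derivation.\<close>

lemma blade_map_smooth_dir_deriv:
  fixes a :: "'n uvec"
  assumes t: "extensor_field11 \<kappa> U t" and p: "p \<in> U" and k: "linear k" "\<And>v. t p (k v) = v"
  defines "N \<equiv> \<lambda>v. k (dir_deriv \<kappa> a (\<lambda>q. t q v) p)"
  shows "smooth_field \<kappa> U (\<lambda>q. blade_map (t q) is)" (is ?S)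
    and "dir_deriv \<kappa> a (\<lambda>q. blade_map (t q) is) p =
      mv_ext (t p) (mv_derivation N (blade_map (\<lambda>x. x) is))" (is ?D)
proof -
  have lin: "linear (t p)" using t p by (simp add: extensor_field11_def)
  have N: "linear N"
    unfolding N_def using linear_compose[OF linear_dir_deriv_apply[OF t p] k(1)]
        by (simp add: o_def)
  \<comment> \<open>Both claims are proved in one induction, since the product rule asks for
    smoothness of the shorter blade.\<close>
  have "?S \<and> ?D"
  proof (induction "is")
    case Nil
    show ?case
      by (simp add: blade_map_def smooth_field_const dir_deriv_const[OF p] mv_derivation_one
          linear_0[OF linear_mv_ext])
  next
    case (Cons i "is")
    have cons: "blade_map t (i # is) = mv_vec (t (bas i)) \<and>\<^sub>m blade_map t is" for t :: "'n uvec \<Rightarrow>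
        'n uvec"
      by (simp add: blade_map_def)
    have s: "smooth_field \<kappa> U (\<lambda>q. t q (bas i))" using t by (simp add: extensor_field11_def)
    note sv = smooth_field_bounded_linear[OF bounded_linear_mv_vec s]
    note sb = Cons[THEN conjunct1]
    have "smooth_field \<kappa> U (\<lambda>q. blade_map (t q) (i # is))"
      unfolding cons by (rule smooth_field_bounded_bilinear[OF bounded_bilinear_wedge sv sb])
    moreover have "dir_deriv \<kappa> a (\<lambda>q. blade_map (t q) (i # is)) p =
        mv_ext (t p) (mv_derivation N (blade_map (\<lambda>x. x) (i # is)))"
      unfolding cons dir_deriv_bounded_bilinear[OF bounded_bilinear_wedge sv sb p]
        dir_deriv_bounded_linear[OF bounded_linear_mv_vec s p] mv_derivation_vec_wedge[OF N]
        linear_add[OF linear_mv_ext] mv_ext_vec_wedge[OF lin] Cons[THEN conjunct2]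
      by (simp add: N_def k(2) blade_map_eq_mv_ext[OF lin])
    ultimately show ?case ..
  qed
  then show ?S ?D by blast+
qed

lemma dir_deriv_mv_ext:
  assumes t: "extensor_field11 \<kappa> U t" and p: "p \<in> U" and k: "linear k" "\<And>v. t p (k v) = v"
    and X: "smooth_field \<kappa> U X"
  shows "dir_deriv \<kappa> a (\<lambda>q. mv_ext (t q) (X q)) p = mv_ext (t p) (dir_deriv \<kappa> a X p +
    mv_derivation (\<lambda>v. k (dir_deriv \<kappa> a (\<lambda>q. t q v) p)) (X p))"
proof -
  let ?N = "\<lambda>v. k (dir_deriv \<kappa> a (\<lambda>q. t q v) p)"
  have lin: "linear (t p)" using t p by (simp add: extensor_field11_def)
  note sb = blade_map_smooth_dir_deriv(1)[OF t p k]
  note sX = smooth_field_nth[OF X]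
  let ?m = "\<lambda>Y. mv_ext (t p) (mv_derivation ?N Y)"
  have m: "linear ?m"
    using linear_compose[OF linear_mv_derivation linear_mv_ext] by (simp add: o_def)
  have ext: "(\<lambda>q. mv_ext (t q) (X q)) = (\<lambda>q. \<Sum>A\<in>UNIV. X q $ A *\<^sub>R blade_map (t q)
      (sorted_list_of_set A))"
    by (simp add: mv_ext_def)
  have "dir_deriv \<kappa> a (\<lambda>q. mv_ext (t q) (X q)) p =
      (\<Sum>A\<in>UNIV. X p $ A *\<^sub>R ?m (axis A 1) + dir_deriv \<kappa> a X p $ A *\<^sub>R blade_map (t p)
          (sorted_list_of_set A))"
    unfolding ext by (subst dir_deriv_sum)
      (simp_all add: dir_deriv_bounded_bilinear[OF bounded_bilinear_scaleR sX sb]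
          smooth_field_scaleR[OF sX sb] p
        dir_deriv_bounded_linear[OF bounded_linear_vec_nth X p] blade_map_smooth_dir_deriv(2)[OF t
            p k]
        blade_map_id)
  also have "\<dots> = ?m (\<Sum>A\<in>UNIV. X p $ A *\<^sub>R axis A 1) + mv_ext (t p) (dir_deriv \<kappa> a X p)"
    by (simp add: sum.distrib linear_sum[OF m] linear_cmul[OF m] mv_ext_def[of _ "dir_deriv \<kappa> a X
        p"])
  finally show ?thesis by (simp add: mv_expansion linear_add[OF linear_mv_ext])
qed

end


section \<open>The Levi-Civita connection\<close>

locale metric_region = chart_region \<kappa> U
  for \<kappa> :: "('m::topological_space, 'n::{finite,linorder}) chart" and U +
  fixes g :: "'m \<Rightarrow> 'n uvec \<Rightarrow> 'n uvec"
  assumes metric: "metric_field \<kappa> U g"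
begin

lemma g_ext: "extensor_field11 \<kappa> U g"
  using metric by (simp add: metric_field_def)

lemma g_linear: "p \<in> U \<Longrightarrow> linear (g p)"
  and g_smooth: "smooth_field \<kappa> U (\<lambda>p. g p v)"
  using g_ext by (simp_all add: extensor_field11_def)

lemma g_sym: "p \<in> U \<Longrightarrow> g p u \<bullet> v = u \<bullet> g p v"
  using metric adjoint_works[OF g_linear, of p u v] by (simp add: metric_field_def)

lemma g_sym_swap: "p \<in> U \<Longrightarrow> g p u \<bullet> v = g p v \<bullet> u"
  using g_sym[of p u v] by (simp only: inner_commute[of u])

lemma g_inv: "p \<in> U \<Longrightarrow> g p (inv (g p) v) = v"
proof -
  assume p: "p \<in> U"
  then have "inj (g p)" using metric det_nz_iff_inj[OF g_linear[OF p]]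
      by (simp add: metric_field_def)
  then show "g p (inv (g p) v) = v"
      by (rule surj_f_inv_f[OF linear_inj_imp_surj[OF g_linear[OF p]]])
qed

lemma g_inv_linear: "p \<in> U \<Longrightarrow> linear (inv (g p))"
  using extensor_field11_inv[OF g_ext] metric by (simp add: metric_field_def extensor_field11_def)

definition dg :: "'m \<Rightarrow> 'n uvec \<Rightarrow> 'n uvec \<Rightarrow> 'n uvec"
  where "dg p a b = dir_deriv \<kappa> a (\<lambda>q. g q b) p"

lemma dg_linear_left: "linear (\<lambda>a. dg p a b)"
  unfolding dg_def by (rule linear_dir_deriv)

lemma dg_linear_right: "p \<in> U \<Longrightarrow> linear (dg p a)"
  unfolding dg_def by (rule linear_dir_deriv_apply[OF g_ext])

lemma dg_sym: "p \<in> U \<Longrightarrow> dg p a u \<bullet> v = u \<bullet> dg p a v"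
proof -
  assume p: "p \<in> U"
  have eq: "dir_deriv \<kappa> a (\<lambda>q. g q u \<bullet> v) p = dg p a u \<bullet> v" for u v
    unfolding dg_def
    by (rule dir_deriv_bounded_linear[OF bounded_linear_inner_left g_smooth p])
  have "dir_deriv \<kappa> a (\<lambda>q. g q u \<bullet> v) p = dir_deriv \<kappa> a (\<lambda>q. g q v \<bullet> u) p"
    by (rule dir_deriv_cong[OF g_sym_swap _ p], assumption)
      (intro smooth_field_inner g_smooth smooth_field_const)
  then show "dg p a u \<bullet> v = u \<bullet> dg p a v"
    unfolding eq by (simp only: inner_commute[of u])
qed

text \<open>The Levi-Civita connection in Koszul form for constant \<open>b\<close>. The sum over
  \<open>\<mu>\<close> is the vector representing the functional
  \<open>c \<mapsto> a \<bullet> dg p c b\<close>.\<close>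

definition lc_vec :: "'m \<Rightarrow> 'n uvec \<Rightarrow> 'n uvec \<Rightarrow> 'n uvec"
  where "lc_vec p a b = inv (g p) ((1/2) *\<^sub>R
    (dg p a b + dg p b a - (\<Sum>\<mu>\<in>UNIV. (a \<bullet> dg p (bas \<mu>) b) *\<^sub>R bas \<mu>)))"

lemma lc_vec_linear_right: "p \<in> U \<Longrightarrow> linear (lc_vec p a)"
  unfolding lc_vec_def
  by (intro linear_compose[OF _ g_inv_linear, unfolded o_def] linear_compose_scale_right
      linear_compose_sub linear_compose_add dg_linear_left dg_linear_right)
    (auto intro!: linearI simp: linear_add[OF dg_linear_right] linear_cmul[OF dg_linear_right]
      inner_add_right sum.distrib scaleR_sum_right algebra_simps)

lemma lc_vec_linear_left: "p \<in> U \<Longrightarrow> linear (\<lambda>a. lc_vec p a b)"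
  unfolding lc_vec_def
  by (intro linear_compose[OF _ g_inv_linear, unfolded o_def] linear_compose_scale_right
      linear_compose_sub linear_compose_add dg_linear_left dg_linear_right)
    (auto intro!: linearI simp: inner_add_left sum.distrib scaleR_sum_right algebra_simps)

lemma lc_vec_inner:
  assumes "p \<in> U"
  shows "g p (lc_vec p a b) \<bullet> c = (dg p a b \<bullet> c + dg p b a \<bullet> c - a \<bullet> dg p c b) / 2"
proof -
  have "(\<Sum>\<mu>\<in>UNIV. (a \<bullet> dg p (bas \<mu>) b) *\<^sub>R bas \<mu>) \<bullet> c = (\<Sum>\<mu>\<in>UNIV. (a \<bullet> (c $ \<mu> *\<^sub>R dg p (bas \<mu>) b)))"
    by (simp add: inner_sum_left inner_axis' mult.commute)
  also have "\<dots> = a \<bullet> dg p (\<Sum>\<mu>\<in>UNIV. c $ \<mu> *\<^sub>R bas \<mu>) b"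
    by (simp only: inner_sum_right linear_sum[OF dg_linear_left] linear_cmul[OF dg_linear_left])
  finally show ?thesis
    by (simp add: lc_vec_def g_inv[OF assms] uvec_expansion inner_add_left inner_diff_left)
qed

text \<open>The first summand of \<open>lc_lambda\<close> is the \<open>dg p a b\<close> part of
  \<open>lc_vec\<close>. The bivector supplies the rest: contracting one index of its antisymmetric
  coefficients with \<open>b\<close> leaves \<open>dg p b a\<close> and the sum over
  \<open>bas \<mu>\<close>.\<close>

lemma lc_lambda_eq:
  assumes p: "p \<in> U"
  shows "lc_lambda \<kappa> g p a b = mv_vec (lc_vec p a b)"
proof -
  define u where "u \<mu> = inv (g p) (bas \<mu>)" for \<mu>
  define c where "c \<mu> \<nu> = a \<bullet> (dg p (bas \<mu>) (bas \<nu>) - dg p (bas \<nu>) (bas \<mu>))" for \<mu> \<nu>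
  have gu: "g p (u \<mu>) = bas \<mu>" for \<mu> by (simp add: u_def g_inv[OF p])
  have omega: "lc_omega \<kappa> g p a =
      - (1/4) *\<^sub>R (\<Sum>\<mu>\<in>UNIV. \<Sum>\<nu>\<in>UNIV. c \<mu> \<nu> *\<^sub>R (mv_vec (u \<mu>) \<and>\<^sub>m mv_vec (u \<nu>)))"
    by (simp add: lc_omega_def c_def u_def dg_def dir_deriv_ext_eq[OF g_ext p])
  \<comment> \<open>Symmetry of \<open>dg p b\<close> turns the second term into a component of
    \<open>dg p b a\<close>.\<close>
  have c: "(\<Sum>\<nu>\<in>UNIV. c \<mu> \<nu> * b $ \<nu>) = a \<bullet> dg p (bas \<mu>) b - dg p b a \<bullet> bas \<mu>" for \<mu>
  proof -
    have "(\<Sum>\<nu>\<in>UNIV. c \<mu> \<nu> * b $ \<nu>) = a \<bullet> dg p (bas \<mu>) (\<Sum>\<nu>\<in>UNIV. b $ \<nu> *\<^sub>R bas \<nu>) -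
        a \<bullet> dg p (\<Sum>\<nu>\<in>UNIV. b $ \<nu> *\<^sub>R bas \<nu>) (bas \<mu>)"
      by (simp add: linear_sum[OF dg_linear_right[OF p]] linear_cmul[OF dg_linear_right[OF p]]
          linear_sum[OF dg_linear_left] linear_cmul[OF dg_linear_left] c_def inner_sum_right
          inner_diff_right sum_subtractf algebra_simps)
    then show ?thesis by (simp only: uvec_expansion dg_sym[OF p])
  qed
  have "comm_prod (g p) (lc_omega \<kappa> g p a) (mv_vec b) = - (1/4) *\<^sub>R (\<Sum>\<mu>\<in>UNIV. \<Sum>\<nu>\<in>UNIV. c \<mu> \<nu> *\<^sub>R
      (mv_vec (b $ \<nu> *\<^sub>R u \<mu>) - mv_vec (b $ \<mu> *\<^sub>R u \<nu>)))"
    unfolding omega linear_cmul[OF linear_comm_prod_left] comm_prod_plane_sum[OF g_linear[OF p]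
        g_sym[OF p]]
    by (simp add: gu lcontr_vec wedge_linear_simps wedge_one mv_vec_linear_simps inner_axis')
  also have "\<dots> = - (1/2) *\<^sub>R (\<Sum>\<mu>\<in>UNIV. \<Sum>\<nu>\<in>UNIV. c \<mu> \<nu> *\<^sub>R mv_vec (b $ \<nu> *\<^sub>R u \<mu>))"
    by (subst sum_antisymmetric) (simp_all add: c_def inner_diff_right)
  also have "\<dots> = mv_vec (- (1/2) *\<^sub>R (\<Sum>\<mu>\<in>UNIV. (\<Sum>\<nu>\<in>UNIV. c \<mu> \<nu> * b $ \<nu>) *\<^sub>R u \<mu>))"
    by (simp add: mv_vec_linear_simps scaleR_sum_left)
  also have "\<dots> = mv_vec (inv (g p) ((1/2) *\<^sub>R (\<Sum>\<mu>\<in>UNIV. (dg p b a $ \<mu>) *\<^sub>R bas \<mu> -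
      (a \<bullet> dg p (bas \<mu>) b) *\<^sub>R bas \<mu>)))"
    by (simp add: c u_def linear_cmul[OF g_inv_linear[OF p]] linear_sum[OF g_inv_linear[OF p]]
        linear_diff[OF g_inv_linear[OF p]] inner_axis scaleR_left_diff_distrib sum_subtractf
        scaleR_right_diff_distrib mv_vec_linear_simps)
  also have "\<dots> = mv_vec (inv (g p) ((1/2) *\<^sub>R (dg p b a -
      (\<Sum>\<mu>\<in>UNIV. (a \<bullet> dg p (bas \<mu>) b) *\<^sub>R bas \<mu>))))"
    by (simp only: sum_subtractf uvec_expansion)
  finally show ?thesis
    by (simp add: lc_lambda_def lc_vec_def dir_deriv_ext_eq[OF g_ext p] dg_def[symmetric]
        linear_cmul[OF g_inv_linear[OF p]] linear_add[OF g_inv_linear[OF p]]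
        linear_diff[OF g_inv_linear[OF p]] scaleR_right_diff_distrib scaleR_right_distrib
        mv_vec_linear_simps)
qed

lemma lc_Lambda_eq: "p \<in> U \<Longrightarrow> lc_Lambda \<kappa> g p a X = mv_derivation (lc_vec p a) X"
  by (simp add: lc_Lambda_def mv_derivation_def lc_lambda_eq)

lemma dir_deriv_metric_prod:
  assumes "smooth_field \<kappa> U b" "smooth_field \<kappa> U c" "p \<in> U"
  shows "dir_deriv \<kappa> a (metric_prod g b c) p =
    g p (b p) \<bullet> dir_deriv \<kappa> a c p + g p (dir_deriv \<kappa> a b p) \<bullet> c p + dg p a (b p) \<bullet> c p"
  unfolding metric_prod_def
    dir_deriv_bounded_bilinear[OF bounded_bilinear_inner smooth_field_apply[OF g_ext assms(1)]
        assms(2,3)]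
    dir_deriv_apply[OF g_ext assms(1,3)] dg_def
  by (simp add: inner_add_left)

text \<open>The Koszul formula. After the product rule, derivatives of the fields cancel against the
  brackets, except for the derivative of \<open>b\<close> along \<open>a\<close>, which occurs
  twice; the derivatives of \<open>g\<close> are the three terms of
  \<open>lc_vec_inner\<close>.\<close>

lemma christoffel1_eq:
  assumes "smooth_field \<kappa> U a" "smooth_field \<kappa> U b" "smooth_field \<kappa> U c" "p \<in> U"
  shows "christoffel1 \<kappa> g a b c p =
    g p (dir_deriv \<kappa> (a p) b p + lc_vec p (a p) (b p)) \<bullet> c p"
proof -
  note p = assms(4)
  note sym = g_sym_swap[OF p]
  have dsym: "dg p x u \<bullet> v = dg p x v \<bullet> u" for x u v
    using dg_sym[OF p, of x u v] by (simp only: inner_commute[of u])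
  show ?thesis
    unfolding christoffel1_def dir_deriv_metric_prod[OF assms(2,3) p]
      dir_deriv_metric_prod[OF assms(3,1) p] dir_deriv_metric_prod[OF assms(1,2) p]
      linear_add[OF g_linear[OF p]] inner_add_left lc_vec_inner[OF p]
    unfolding metric_prod_def lie_bracket_def linear_diff[OF g_linear[OF p]] inner_diff_right
    using dsym[of "b p" "c p" "a p"] dsym[of "c p" "a p" "b p"] inner_commute[of "a p" "dg p (c p)
        (b p)"]
      sym[of "b p" "dir_deriv \<kappa> (a p) c p"] sym[of "c p" "dir_deriv \<kappa> (b p) a p"]
      sym[of "a p" "dir_deriv \<kappa> (c p) b p"] sym[of "c p" "dir_deriv \<kappa> (a p) b p"]
      sym[of "b p" "dir_deriv \<kappa> (c p) a p"] sym[of "a p" "dir_deriv \<kappa> (b p) c p"]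
    by (simp add: field_simps)
qed

text \<open>Metric compatibility: adding \<open>lc_vec_inner\<close> to its copy with
  \<open>b\<close> and \<open>c\<close> exchanged, the \<open>dg p a\<close> terms combine to the
  derivative of \<open>g\<close>, and the other four cancel by symmetry of
  \<open>dg\<close>.\<close>

lemma lc_vec_metric:
  assumes "smooth_field \<kappa> U b" "smooth_field \<kappa> U c" "p \<in> U"
  shows "dir_deriv \<kappa> a (metric_prod g b c) p =
    g p (dir_deriv \<kappa> a b p + lc_vec p a (b p)) \<bullet> c p + g p (dir_deriv \<kappa> a c p +
        lc_vec p a (c p)) \<bullet> b p"
proof -
  note p = assms(3)
  have dsym: "dg p x u \<bullet> v = dg p x v \<bullet> u" for x u v
    using dg_sym[OF p, of x u v] by (simp only: inner_commute[of u])
  show ?thesis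
    unfolding dir_deriv_metric_prod[OF assms] linear_add[OF g_linear[OF p]] inner_add_left
      lc_vec_inner[OF p]
    using dsym[of "b p" a "c p"] dsym[of "c p" a "b p"] dsym[of a "b p" "c p"]
      inner_commute[of a "dg p (c p) (b p)"] inner_commute[of a "dg p (b p) (c p)"]
      g_sym[OF p, of "b p" "dir_deriv \<kappa> a c p"] inner_commute[of "b p" "g p (dir_deriv \<kappa> a c p)"]
    by (simp add: field_simps)
qed

end


section \<open>The gauge connection\<close>

locale gauge_region = metric_region \<kappa> U g
  for \<kappa> :: "('m::topological_space, 'n::{finite,linorder}) chart" and U
    and g :: "'m \<Rightarrow> 'n uvec \<Rightarrow> 'n uvec" +
  fixes \<eta> h :: "'m \<Rightarrow> 'n uvec \<Rightarrow> 'n uvec"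
  assumes gauge: "gauge_metric_field \<kappa> U g \<eta> h"
    and eta_const: "\<forall>p\<in>U. \<forall>a b. dir_deriv_ext \<kappa> a \<eta> b p = 0"
begin

sublocale eta: metric_region \<kappa> U \<eta>
  using gauge by unfold_locales (simp add: gauge_metric_field_def orthogonal_metric_field_def)

lemma eta_eta: "p \<in> U \<Longrightarrow> \<eta> p (\<eta> p v) = v"
proof -
  assume p: "p \<in> U"
  then have "\<eta> p = adjoint (\<eta> p)" and "adjoint (\<eta> p) = inv (\<eta> p)"
    using gauge by (auto simp: gauge_metric_field_def orthogonal_metric_field_def)
  then have "inv (\<eta> p) = \<eta> p" by simp
  with eta.g_inv[OF p, of v] show "\<eta> p (\<eta> p v) = v" by simp
qed

lemma h_ext: "extensor_field11 \<kappa> U h"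
  using gauge by (simp add: gauge_metric_field_def)

lemma h_linear: "p \<in> U \<Longrightarrow> linear (h p)"
  using h_ext by (simp add: extensor_field11_def)

lemma h_inj: "p \<in> U \<Longrightarrow> inj (h p)"
  using gauge det_nz_iff_inj[OF h_linear] by (simp add: gauge_metric_field_def)

definition h_inv :: "'m \<Rightarrow> 'n uvec \<Rightarrow> 'n uvec"
  where "h_inv p = inv (h p)"

lemma h_inv_ext: "extensor_field11 \<kappa> U h_inv"
  using extensor_field11_inv[OF h_ext] gauge unfolding h_inv_def
      by (simp add: gauge_metric_field_def)

lemma h_inv_linear: "p \<in> U \<Longrightarrow> linear (h_inv p)"
  and h_inv_smooth: "smooth_field \<kappa> U (\<lambda>q. h_inv q v)"
  using h_inv_ext by (simp_all add: extensor_field11_def)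

lemma h_inv_h: "p \<in> U \<Longrightarrow> h_inv p (h p v) = v"
  by (simp add: h_inv_def h_inj)

lemma h_h_inv: "p \<in> U \<Longrightarrow> h p (h_inv p v) = v"
  unfolding h_inv_def by (rule surj_f_inv_f[OF linear_inj_imp_surj[OF h_linear h_inj]])

lemma g_eq: "p \<in> U \<Longrightarrow> g p u \<bullet> v = \<eta> p (h p u) \<bullet> h p v"
  using gauge adjoint_works[OF h_linear, of p v "\<eta> p (h p u)"]
  by (simp add: gauge_metric_field_def inner_commute)

text \<open>The map \<open>M\<^sub>a\<close> of the overview. Its argument \<open>v\<close> is a
  constant vector, so the derivative falls on \<open>h_inv\<close> alone.\<close>

definition gauge_op :: "'m \<Rightarrow> 'n uvec \<Rightarrow> 'n uvec \<Rightarrow> 'n uvec"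
  where "gauge_op p a v = h p (dir_deriv \<kappa> a (\<lambda>q. h_inv q v) p + lc_vec p a (h_inv p v))"

lemma gauge_op_linear_left: "p \<in> U \<Longrightarrow> linear (\<lambda>a. gauge_op p a v)"
  unfolding gauge_op_def
  by (intro linear_compose[OF _ h_linear, unfolded o_def] linear_compose_add
      linear_dir_deriv lc_vec_linear_left)

text \<open>Derivative and connection term both come out as images under
  \<open>mv_ext (h_inv p)\<close>, which the outer \<open>mv_ext (h p)\<close> cancels; the two
  derivations then add up to that of \<open>gauge_op\<close>.\<close>

lemma gauge_deriv_eq:
  assumes X: "smooth_field \<kappa> U X" and p: "p \<in> U"
  shows "gauge_deriv \<kappa> g h a X p = dir_deriv \<kappa> a X p + mv_derivation (gauge_op p a) (X p)"
proof -
  have "dir_deriv \<kappa> a (\<lambda>q. mv_ext (h_inv q) (X q)) p = mv_ext (h_inv p) (dir_deriv \<kappa> a X p +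
      mv_derivation (\<lambda>v. h p (dir_deriv \<kappa> a (\<lambda>q. h_inv q v) p)) (X p))"
    by (rule dir_deriv_mv_ext[OF h_inv_ext p h_linear[OF p] h_inv_h[OF p] X])
  moreover have "mv_derivation (lc_vec p a) (mv_ext (h_inv p) (X p)) =
      mv_ext (h_inv p) (mv_derivation (\<lambda>v. h p (lc_vec p a (h_inv p v))) (X p))"
    by (rule mv_derivation_mv_ext[OF h_linear[OF p] h_inv_linear[OF p] h_inv_h[OF p]
        lc_vec_linear_right[OF p]])
  ultimately have "lc_deriv \<kappa> g a (\<lambda>q. mv_ext (h_inv q) (X q)) p =
      mv_ext (h_inv p) (dir_deriv \<kappa> a X p + mv_derivation (gauge_op p a) (X p))"
    by (simp add: lc_deriv_def lc_Lambda_eq[OF p] gauge_op_def[abs_def] linear_add[OF h_linear[OF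
        p]]
        mv_derivation_add_op linear_add[OF linear_mv_ext] add.assoc)
  then show ?thesis
    unfolding gauge_deriv_def h_inv_def[symmetric]
    by (simp add: mv_ext_mv_ext_inverse[OF h_linear[OF p] h_inv_linear[OF p] h_h_inv[OF p]])
qed

lemma christoffel1_gauge:
  assumes "smooth_field \<kappa> U a" "p \<in> U"
  shows "christoffel1 \<kappa> g a (\<lambda>q. h_inv q b) (\<lambda>q. h_inv q c) p = \<eta> p (gauge_op p (a p) b) \<bullet> c"
  by (simp add: christoffel1_eq[OF assms(1) h_inv_smooth h_inv_smooth assms(2)] g_eq h_h_inv
      gauge_op_def assms(2))

text \<open>
  The products \<open>g(h\<inverse>(b)) \<cdot> h\<inverse>(c) = \<eta>(b) \<cdot> c\<close> are constant, so metric compatibility of the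
  Levi-Civita derivative forces antisymmetry.
\<close>

lemma gauge_op_antisym:
  assumes p: "p \<in> U"
  shows "\<eta> p (gauge_op p a b) \<bullet> c = - (\<eta> p (gauge_op p a c) \<bullet> b)"
proof -
  have "dir_deriv \<kappa> a (metric_prod g (\<lambda>q. h_inv q b) (\<lambda>q. h_inv q c)) p = dir_deriv \<kappa> a (\<lambda>q. \<eta> q b
      \<bullet> c) p"
    by (rule dir_deriv_cong[OF _ _ p])
      (simp_all add: metric_prod_def g_eq h_h_inv smooth_field_inner eta.g_smooth
          smooth_field_const)
  also have "\<dots> = dir_deriv \<kappa> a (\<lambda>q. \<eta> q b) p \<bullet> c"
    by (rule dir_deriv_bounded_linear[OF bounded_linear_inner_left eta.g_smooth p])
  also have "\<dots> = 0"
    using eta_const p dir_deriv_ext_eq[OF eta.g_ext p] by simp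
  finally show ?thesis
    by (simp add: lc_vec_metric[OF h_inv_smooth h_inv_smooth p] g_eq h_h_inv gauge_op_def p)
qed

text \<open>Written with \<open>gauge_op\<close>, since \<open>christoffel1\<close> takes a vector
  field: here only the value of \<open>a\<close> at \<open>p\<close> enters, and linearity in it is
  visible.\<close>

definition gauge_omega :: "'m \<Rightarrow> 'n uvec \<Rightarrow> 'n mv"
  where "gauge_omega p a = - (1/2) *\<^sub>R (\<Sum>\<mu>\<in>UNIV. \<Sum>\<nu>\<in>UNIV.
    (\<eta> p (gauge_op p a (bas \<mu>)) \<bullet> bas \<nu>) *\<^sub>R (mv_vec (\<eta> p (bas \<mu>)) \<and>\<^sub>m mv_vec (\<eta> p (bas \<nu>))))"

lemma gauge_omega_eq_christoffel1:
  assumes "smooth_field \<kappa> U a" "p \<in> U"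
  shows "gauge_omega p (a p) = - (1/2) *\<^sub>R (\<Sum>\<mu>\<in>UNIV. \<Sum>\<nu>\<in>UNIV.
    christoffel1 \<kappa> g a (\<lambda>q. h_inv q (bas \<mu>)) (\<lambda>q. h_inv q (bas \<nu>)) p *\<^sub>R
      (mv_vec (\<eta> p (bas \<mu>)) \<and>\<^sub>m mv_vec (\<eta> p (bas \<nu>))))"
  by (simp only: christoffel1_gauge[OF assms] gauge_omega_def)

text \<open>Antisymmetry of \<open>c\<close> is used twice: to merge the halves of the commutator,
  which cancels \<open>1/2\<close>, and to absorb the minus sign. The inner sum left over is
  \<open>\<eta> p\<close> applied twice to \<open>gauge_op p a (bas \<nu>)\<close>.\<close>

lemma comm_prod_gauge_omega:
  assumes p: "p \<in> U"
  shows "comm_prod (\<eta> p) (gauge_omega p a) X = mv_derivation (gauge_op p a) X"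
proof -
  define c where "c \<mu> \<nu> = \<eta> p (gauge_op p a (bas \<mu>)) \<bullet> bas \<nu>" for \<mu> \<nu>
  have anti: "c \<mu> \<nu> = - c \<nu> \<mu>" for \<mu> \<nu> unfolding c_def by (rule gauge_op_antisym[OF p])
  have expand: "(\<Sum>\<mu>\<in>UNIV. c \<nu> \<mu> *\<^sub>R \<eta> p (bas \<mu>)) = gauge_op p a (bas \<nu>)" for \<nu>
  proof -
    have "(\<Sum>\<mu>\<in>UNIV. c \<nu> \<mu> *\<^sub>R \<eta> p (bas \<mu>)) =
        \<eta> p (\<Sum>\<mu>\<in>UNIV. \<eta> p (gauge_op p a (bas \<nu>)) $ \<mu> *\<^sub>R bas \<mu>)"
      by (simp add: linear_sum[OF eta.g_linear[OF p]] linear_cmul[OF eta.g_linear[OF p]] c_def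
          inner_axis)
    then show ?thesis by (simp only: uvec_expansion eta_eta[OF p])
  qed
  have "comm_prod (\<eta> p) (gauge_omega p a) X = - (1/2) *\<^sub>R (\<Sum>\<mu>\<in>UNIV. \<Sum>\<nu>\<in>UNIV. c \<mu> \<nu> *\<^sub>R
      (mv_vec (\<eta> p (bas \<mu>)) \<and>\<^sub>m (bas \<nu> \<rfloor>\<^sub>m X) - mv_vec (\<eta> p (bas \<nu>)) \<and>\<^sub>m (bas \<mu> \<rfloor>\<^sub>m X)))"
    unfolding gauge_omega_def c_def[symmetric] linear_cmul[OF linear_comm_prod_left]
      comm_prod_plane_sum[OF eta.g_linear[OF p] eta.g_sym[OF p]] eta_eta[OF p] ..
  also have "\<dots> = - (\<Sum>\<mu>\<in>UNIV. \<Sum>\<nu>\<in>UNIV. c \<mu> \<nu> *\<^sub>R (mv_vec (\<eta> p (bas \<mu>)) \<and>\<^sub>m (bas \<nu> \<rfloor>\<^sub>m X)))"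
    by (subst sum_antisymmetric[of c, OF anti]) simp
  also have "\<dots> = (\<Sum>\<mu>\<in>UNIV. \<Sum>\<nu>\<in>UNIV. c \<nu> \<mu> *\<^sub>R (mv_vec (\<eta> p (bas \<mu>)) \<and>\<^sub>m (bas \<nu> \<rfloor>\<^sub>m X)))"
    by (simp only: anti[symmetric] sum_negf[symmetric] scaleR_minus_left[symmetric])
  also have "\<dots> = (\<Sum>\<nu>\<in>UNIV. \<Sum>\<mu>\<in>UNIV. c \<nu> \<mu> *\<^sub>R (mv_vec (\<eta> p (bas \<mu>)) \<and>\<^sub>m (bas \<nu> \<rfloor>\<^sub>m X)))"
    by (rule sum.swap)
  also have "\<dots> = (\<Sum>\<nu>\<in>UNIV. mv_vec (\<Sum>\<mu>\<in>UNIV. c \<nu> \<mu> *\<^sub>R \<eta> p (bas \<mu>)) \<and>\<^sub>m (bas \<nu> \<rfloor>\<^sub>m X))"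
    by (simp only: mv_vec_linear_simps wedge_linear_simps)
  finally show ?thesis by (simp only: expand mv_derivation_def)
qed

section \<open>The connection as a smooth extensor field, and its uniqueness\<close>

lemma bivector_gauge_omega: "bivector (gauge_omega p a)"
  unfolding gauge_omega_def by (intro bivector_scaleR bivector_sum bivector_plane)

lemma linear_gauge_omega: "p \<in> U \<Longrightarrow> linear (gauge_omega p)"
  unfolding gauge_omega_def[abs_def]
  by (rule linearI)
    (simp_all add: linear_add[OF gauge_op_linear_left] linear_cmul[OF gauge_op_linear_left]
      linear_add[OF eta.g_linear] linear_cmul[OF eta.g_linear] inner_add_left
      scaleR_sum_right sum.distrib algebra_simps)

lemma smooth_christoffel1:
  assumes "smooth_field \<kappa> U a" "smooth_field \<kappa> U b" "smooth_field \<kappa> U c"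
  shows "smooth_field \<kappa> U (christoffel1 \<kappa> g a b c)"
  unfolding christoffel1_def[abs_def] metric_prod_def lie_bracket_def
  by (intro smooth_field_mult smooth_field_const smooth_field_add smooth_field_diff
      smooth_field_dir_deriv smooth_field_inner smooth_field_apply[OF g_ext] assms)

text \<open>The Christoffel formula for the constant field \<open>v\<close> involves only
  derivatives and products of smooth fields.\<close>

lemma smooth_gauge_omega: "smooth_field \<kappa> U (\<lambda>p. gauge_omega p v)"
proof -
  have "smooth_field \<kappa> U (\<lambda>p. - (1/2) *\<^sub>R (\<Sum>\<mu>\<in>UNIV. \<Sum>\<nu>\<in>UNIV.
    christoffel1 \<kappa> g (\<lambda>_. v) (\<lambda>q. h_inv q (bas \<mu>)) (\<lambda>q. h_inv q (bas \<nu>)) p *\<^sub>R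
      (mv_vec (\<eta> p (bas \<mu>)) \<and>\<^sub>m mv_vec (\<eta> p (bas \<nu>)))))"
    by (intro smooth_field_scaleR smooth_field_const smooth_field_sum smooth_christoffel1
        h_inv_smooth
        smooth_field_bounded_bilinear[OF bounded_bilinear_wedge]
        smooth_field_bounded_linear[OF bounded_linear_mv_vec] eta.g_smooth)
  then show ?thesis
    by (rule smooth_field_cong[THEN iffD1, rotated])
      (simp only: gauge_omega_eq_christoffel1[OF smooth_field_const, symmetric])
qed

lemma gauge_connection_gauge_omega: "gauge_connection \<kappa> U g \<eta> h gauge_omega"
  by (simp add: gauge_connection_def extensor_field12_def linear_gauge_omega bivector_gauge_omega
      smooth_gauge_omega gauge_deriv_eq comm_prod_gauge_omega)

text \<open>Constant grade-one fields \<open>X\<close> test the commutator with every vector, and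
  \<open>\<eta> p\<close> is onto because it is its own inverse.\<close>

lemma gauge_connection_unique:
  assumes "gauge_connection \<kappa> U g \<eta> h \<Omega>" "smooth_field \<kappa> U a" "p \<in> U"
  shows "\<Omega> p (a p) = gauge_omega p (a p)"
proof (rule bivector_eq_if_comm_prod_eq[OF eta.g_linear eta.g_sym])
  show "surj (\<eta> p)" using eta_eta[OF assms(3)] by (rule surjI)
  show "bivector (\<Omega> p (a p))"
    using assms by (simp add: gauge_connection_def extensor_field12_def)
  fix v :: "'n uvec"
  have "gauge_deriv \<kappa> g h (a p) (\<lambda>q. mv_vec v) p = dir_deriv \<kappa> (a p) (\<lambda>q. mv_vec v) p +
      comm_prod (\<eta> p) (\<Psi> p (a p)) (mv_vec v)" if "gauge_connection \<kappa> U g \<eta> h \<Psi>" for \<Psi>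
    using that assms(2,3) smooth_field_const[of "mv_vec v"] unfolding gauge_connection_def by blast
  from this[OF assms(1)] this[OF gauge_connection_gauge_omega]
  show "comm_prod (\<eta> p) (\<Omega> p (a p)) (mv_vec v) = comm_prod (\<eta> p) (gauge_omega p (a p)) (mv_vec v)"
    by simp
qed (use assms bivector_gauge_omega in auto)

end

theorem mainTheorem11:
  fixes \<A> :: "('m::{t2_space,second_countable_topology}, 'n::{finite,linorder}) chart set"
    and \<kappa> :: "('m, 'n) chart"
    and U :: "'m set"
    and g \<eta> h :: "'m \<Rightarrow> 'n uvec \<Rightarrow> 'n uvec"
  assumes manifold: "smooth_atlas \<A>"
    and chart: "\<kappa> \<in> \<A>"
    and U: "open U" "U \<subseteq> fst \<kappa>"
    and metric: "metric_field \<kappa> U g"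
    and gauge: "gauge_metric_field \<kappa> U g \<eta> h"
    and eta_const: "\<forall>p\<in>U. \<forall>a b. dir_deriv_ext \<kappa> a \<eta> b p = 0"
  shows "(\<exists>\<Omega>\<^sub>0. gauge_connection \<kappa> U g \<eta> h \<Omega>\<^sub>0) \<and>
    (\<forall>\<Omega>\<^sub>0. gauge_connection \<kappa> U g \<eta> h \<Omega>\<^sub>0 \<longrightarrow>
      (\<forall>a. smooth_field \<kappa> U a \<longrightarrow> (\<forall>p\<in>U.
        \<Omega>\<^sub>0 p (a p) = - (1/2) *\<^sub>R (\<Sum>\<mu>\<in>UNIV. \<Sum>\<nu>\<in>UNIV.
          christoffel1 \<kappa> g a (\<lambda>q. inv (h q) (bas \<mu>)) (\<lambda>q. inv (h q) (bas \<nu>)) p *\<^sub>R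
            (mv_vec (\<eta> p (bas \<mu>)) \<and>\<^sub>m mv_vec (\<eta> p (bas \<nu>)))))))"
proof -
  interpret gauge_region \<kappa> U g \<eta> h
    using manifold chart U metric gauge eta_const by unfold_locales (auto simp: smooth_atlas_def)
  show ?thesis
    using gauge_connection_gauge_omega gauge_connection_unique gauge_omega_eq_christoffel1
    unfolding h_inv_def by auto
qed

end
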